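(* Let $(X,r)$ be a finite nondegenerate square-free symmetric set of order $n$ with $\mathrm{mpl}(X,r)=2$, with $\mathcal G(X,r)$-orbits $X_1,\dots,X_t$ and a complete datum $\mathbb D$. Let $V=\mathbb C X=\bigoplus_{i=1}^t V_i$, $V_i=\mathbb C X_i$, and for $1\le i\le t$ let $Y_i=\{y^i_\eta\mid \eta\in\Lambda_i\}$ be the basis of $V_i$ determined by the datum. Then the linear extension $R:V\otimes V\to V\otimes V$ of $r$, i.e. $R(x\otimes y)={}^xy\otimes x^y$ for $x,y\in X$, has the form $$R(y^i_\eta\otimes y^j_\zeta)=\frac{\mu^i_{j,\zeta}}{\mu^j_{i,\eta}}\; y^j_\zeta\otimes y^i_\eta$$ for all $1\le i,j\le t$, $\eta\in\Lambda_i$, $\zeta\in\Lambda_j$, where $$\mu^j_{i,\eta}=\chi_\eta(\sigma^j_i)=\prod_{1\le k\le s_i}(\theta_{ik}^{\eta_k})^{m^j_{i,k}} .$$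
   Context: A quadratic set $(X,r)$ is a nonempty set $X$ with a bijection $r:X\times X\to X\times X$, written $r(x,y)=({}^xy,x^y)$; put $\mathcal L_x(y)={}^xy$, $\mathcal R_y(x)=x^y$. It is nondegenerate if all $\mathcal L_x,\mathcal R_x$ are bijective, square-free if $r(x,x)=(x,x)$ for all $x$, involutive if $r^2=\mathrm{id}$, and a symmetric set if it is involutive and $r^{12}r^{23}r^{12}=r^{23}r^{12}r^{23}$ on $X^3$, where $r^{12}=r\times\mathrm{id}$, $r^{23}=\mathrm{id}\times r$. For a nondegenerate symmetric set, $x\sim y$ iff $\mathcal L_x=\mathcal L_y$; the retraction $\mathrm{Ret}(X,r)$ is the set $[X]=X/\!\sim$ with the (well-defined) induced nondegenerate symmetric set structure $([x],[y])\mapsto([{}^xy],[x^y])$. $\mathrm{mpl}(X,r)=m$ means $m$ is the minimal integer $\ge 0$ such that $\mathrm{Ret}^m(X,r)$ is a one-element set. $\mathcal G=\mathcal G(X,r)\le \mathrm{Sym}(X)$ is the group generated by all $\mathcal L_x$, $x\in X$. Let $X_1,\dots,X_t$ be the $\mathcal G$-orbits in $X$, with $X_1,\dots,X_{t_0}$ those with more than one element. Known facts for $(X,r)$ finite nondegenerate square-free symmetric with $\mathrm{mpl}(X,r)=2$: $\mathcal G$ is abelian, and $\mathcal L_x=\mathcal L_y$ whenever $x,y$ lie in the same orbit. Denote by $\sigma^j_i\in\mathrm{Sym}(X_i)$ the common restriction $\mathcal L_x|_{X_i}$ for $x\in X_j$. Let $\mathcal G_i\le\mathrm{Sym}(X_i)$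 be the subgroup generated by all $\mathcal L_x|_{X_i}$, $x\in X$; it is abelian and acts transitively, hence regularly, on $X_i$. A complete datum $\mathbb D$ consists, for each $i$ with $1\le i\le t_0$, of: a decomposition $\mathcal G_i=\langle g_{i1}\rangle\times\cdots\times\langle g_{is_i}\rangle$ with $g_{ik}$ of order $p_{ik}$ and $p_{ik}\mid p_{i,k+1}$, $s_i$ being the minimal number of generators of $\mathcal G_i$ (each $g_{ik}$ is written as $\mathcal L_{u_{ik}}|_{X_i}$ with $u_{ik}$ in the semigroup $S(X,r)=\langle X\mid xy=zt \text{ if } r(x,y)=(z,t)\rangle$, which acts on $X$ via the $\mathcal L_x$); a primitive $p_{is_i}$-th root of unity $\theta_i\in\mathbb C$ and $\theta_{ik}=\theta_i^{\,p_{is_i}/p_{ik}}$; and the coordinates $\mathbf m^j_i=(m^j_{i,1},\dots,m^j_{i,s_i})$, $0\le m^j_{i,k}\le p_{ik}-1$, determined by $\sigma^j_i=\prod_k g_{ik}^{m^j_{i,k}}$. For $i>t_0$ (one-element orbits) everything is trivial ($s_i=1$, $p_{i1}=1$, $\theta_{i1}=1$). Let $\Lambda_i=\{\eta=(\eta_1,\dots,\eta_{s_i})\mid 0\le \eta_k\le p_{ik}-1\}$; $\eta\in\Lambda_i$ labels the character $\chi_\eta:\mathcal G_i\to\mathbb C^\times$ with $\chi_\eta(g_{ik})=\theta_{ik}^{\eta_k}$. Fix $x_{i1}\in X_i$ for each $i$ and put $$y^i_\eta=\sum_{\pi\in\mathcal G_i}\chi_\eta(\pi^{-1})\,\pi(x_{i1})\in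 V_i ,$$ so $Y_i=\{x_{i1}\}=X_i$ when $i>t_0$. *)

theory Defs
  imports Complex_Main
    "HOL-Algebra.Group_Action"
    "HOL-Algebra.Generated_Groups"
    "HOL-Algebra.Multiplicative_Group"
    "HOL-Algebra.Product_Groups"
    "HOL-Library.Function_Algebras"
begin

section \<open>Quadratic sets and symmetric sets\<close>

text \<open>A quadratic set is a carrier \<open>X\<close> with a map \<open>r\<close>; the values of \<open>r\<close> off \<open>X \<times> X\<close> are irrelevant.
  With \<open>r (x, y) = (\<^sup>xy, x\<^sup>y)\<close>, the functions \<open>lact r x\<close> and \<open>ract r y\<close> are \<open>L\<^sub>x\<close> and \<open>R\<^sub>y\<close>.\<close>

definition quadratic_set :: "'a set \<Rightarrow> ('a \<times> 'a \<Rightarrow> 'a \<times> 'a) \<Rightarrow> bool" where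
  "quadratic_set X r \<longleftrightarrow> X \<noteq> {} \<and> bij_betw r (X \<times> X) (X \<times> X)"

definition lact :: "('a \<times> 'a \<Rightarrow> 'a \<times> 'a) \<Rightarrow> 'a \<Rightarrow> 'a \<Rightarrow> 'a" where
  "lact r x y = fst (r (x, y))"

definition ract :: "('a \<times> 'a \<Rightarrow> 'a \<times> 'a) \<Rightarrow> 'a \<Rightarrow> 'a \<Rightarrow> 'a" where
  "ract r y x = snd (r (x, y))"

definition nondegenerate :: "'a set \<Rightarrow> ('a \<times> 'a \<Rightarrow> 'a \<times> 'a) \<Rightarrow> bool" where
  "nondegenerate X r \<longleftrightarrow> (\<forall>x\<in>X. bij_betw (lact r x) X X \<and> bij_betw (ract r x) X X)"

definition square_free :: "'a set \<Rightarrow> ('a \<times> 'a \<Rightarrow> 'a \<times> 'a) \<Rightarrow> bool" where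
  "square_free X r \<longleftrightarrow> (\<forall>x\<in>X. r (x, x) = (x, x))"

definition involutive :: "'a set \<Rightarrow> ('a \<times> 'a \<Rightarrow> 'a \<times> 'a) \<Rightarrow> bool" where
  "involutive X r \<longleftrightarrow> (\<forall>x\<in>X. \<forall>y\<in>X. r (r (x, y)) = (x, y))"

definition r12 :: "('a \<times> 'a \<Rightarrow> 'a \<times> 'a) \<Rightarrow> 'a \<times> 'a \<times> 'a \<Rightarrow> 'a \<times> 'a \<times> 'a" where
  "r12 r = (\<lambda>(x, y, z). (fst (r (x, y)), snd (r (x, y)), z))"

definition r23 :: "('a \<times> 'a \<Rightarrow> 'a \<times> 'a) \<Rightarrow> 'a \<times> 'a \<times> 'a \<Rightarrow> 'a \<times> 'a \<times> 'a" where
  "r23 r = (\<lambda>(x, y, z). (x, r (y, z)))"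

definition symmetric_set :: "'a set \<Rightarrow> ('a \<times> 'a \<Rightarrow> 'a \<times> 'a) \<Rightarrow> bool" where
  "symmetric_set X r \<longleftrightarrow> quadratic_set X r \<and> involutive X r \<and>
     (\<forall>v \<in> X \<times> X \<times> X. r12 r (r23 r (r12 r v)) = r23 r (r12 r (r23 r v)))"

section \<open>Retraction and multipermutation level\<close>

definition ret_rel :: "'a set \<Rightarrow> ('a \<times> 'a \<Rightarrow> 'a \<times> 'a) \<Rightarrow> ('a \<times> 'a) set" where
  "ret_rel X r = {(x, y). x \<in> X \<and> y \<in> X \<and> (\<forall>z\<in>X. lact r x z = lact r y z)}"

definition ret_set :: "'a set \<Rightarrow> ('a \<times> 'a \<Rightarrow> 'a \<times> 'a) \<Rightarrow> 'a set set" where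
  "ret_set X r = X // ret_rel X r"

text \<open>Operations on classes are lifted with unions over representatives, as in
  \<^theory>\<open>HOL.Equiv_Relations\<close>; for a nondegenerate symmetric set all members of these
  unions coincide.\<close>

definition ret_map ::
  "'a set \<Rightarrow> ('a \<times> 'a \<Rightarrow> 'a \<times> 'a) \<Rightarrow> 'a set \<times> 'a set \<Rightarrow> 'a set \<times> 'a set" where
  "ret_map X r = (\<lambda>(A, B).
     (\<Union>x\<in>A. \<Union>y\<in>B. ret_rel X r `` {lact r x y},
      \<Union>x\<in>A. \<Union>y\<in>B. ret_rel X r `` {ract r y x}))"

text \<open>The types of the iterated retractions grow, so \<open>mpl (X, r) = 2\<close> is spelled out: two is
  the least \<open>m\<close> for which the \<open>m\<close>-th retraction is a one-element set.\<close>

definition mpl_eq_2 :: "'a set \<Rightarrow> ('a \<times> 'a \<Rightarrow> 'a \<times> 'a) \<Rightarrow> bool" where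
  "mpl_eq_2 X r \<longleftrightarrow>
     \<not> is_singleton X \<and>
     \<not> is_singleton (ret_set X r) \<and>
     is_singleton (ret_set (ret_set X r) (ret_map X r))"

section \<open>The permutation groups, the orbits and the semigroup\<close>

text \<open>The subgroup of \<open>Sym(A)\<close> generated by the restrictions to \<open>A\<close> of all \<open>L\<^sub>x\<close>, \<open>x \<in> X\<close>:
  for \<open>A = X\<close> this is the group \<open>G(X, r)\<close>, for \<open>A = X\<^sub>i\<close> it is \<open>G\<^sub>i\<close>.\<close>

definition perm_group :: "'a set \<Rightarrow> ('a \<times> 'a \<Rightarrow> 'a \<times> 'a) \<Rightarrow> 'a set \<Rightarrow> ('a \<Rightarrow> 'a) monoid" where
  "perm_group X r A = subgroup_generated (BijGroup A) ((\<lambda>x. restrict (lact r x) A) ` X)"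

definition perm_orbits :: "'a set \<Rightarrow> ('a \<times> 'a \<Rightarrow> 'a \<times> 'a) \<Rightarrow> 'a set set" where
  "perm_orbits X r = orbits (perm_group X r X) X (\<lambda>g. g)"

definition orbit_enum ::
  "'a set \<Rightarrow> ('a \<times> 'a \<Rightarrow> 'a \<times> 'a) \<Rightarrow> nat \<Rightarrow> nat \<Rightarrow> (nat \<Rightarrow> 'a set) \<Rightarrow> bool" where
  "orbit_enum X r t t0 Xs \<longleftrightarrow>
     bij_betw Xs {1..t} (perm_orbits X r) \<and> t0 \<le> t \<and>
     (\<forall>i\<in>{1..t}. i \<le> t0 \<longleftrightarrow> card (Xs i) > 1)"

text \<open>Elements of the semigroup \<open>S(X, r)\<close> are classes of nonempty words over \<open>X\<close> modulo the
  congruence generated by \<open>xy = zt\<close> for \<open>r (x, y) = (z, t)\<close>.\<close>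

definition sg_words :: "'a set \<Rightarrow> 'a list set" where
  "sg_words X = {w. w \<noteq> [] \<and> set w \<subseteq> X}"

definition sg_step :: "'a set \<Rightarrow> ('a \<times> 'a \<Rightarrow> 'a \<times> 'a) \<Rightarrow> ('a list \<times> 'a list) set" where
  "sg_step X r = {(a @ [x, y] @ b, a @ [z, t] @ b) | a b x y z t.
     x \<in> X \<and> y \<in> X \<and> r (x, y) = (z, t)}"

definition structure_semigroup :: "'a set \<Rightarrow> ('a \<times> 'a \<Rightarrow> 'a \<times> 'a) \<Rightarrow> 'a list set set" where
  "structure_semigroup X r = sg_words X // (sg_step X r \<union> (sg_step X r)\<inverse>)\<^sup>*"

text \<open>\<open>L\<^sub>u\<close> for \<open>u\<close> in \<open>S(X, r)\<close>; for a symmetric set its values on \<open>X\<close> do not depend on the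
  chosen word.\<close>

definition sg_act :: "('a \<times> 'a \<Rightarrow> 'a \<times> 'a) \<Rightarrow> 'a list set \<Rightarrow> 'a \<Rightarrow> 'a" where
  "sg_act r u = foldr (lact r) (SOME w. w \<in> u)"

text \<open>\<open>sigma r Xs i j\<close> is \<open>\<sigma>\<^sup>j\<^sub>i\<close>, the common restriction to \<open>X\<^sub>i\<close> of the \<open>L\<^sub>x\<close> with \<open>x \<in> X\<^sub>j\<close>.\<close>

definition sigma :: "('a \<times> 'a \<Rightarrow> 'a \<times> 'a) \<Rightarrow> (nat \<Rightarrow> 'a set) \<Rightarrow> nat \<Rightarrow> nat \<Rightarrow> 'a \<Rightarrow> 'a" where
  "sigma r Xs i j = (THE f. \<forall>x\<in>Xs j. f = restrict (lact r x) (Xs i))"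

section \<open>Complete data\<close>

text \<open>Fields:
  \<open>rk i = s\<^sub>i\<close>, \<open>gen i k = g\<^sub>i\<^sub>k\<close>, \<open>word i k = u\<^sub>i\<^sub>k\<close>, \<open>per i k = p\<^sub>i\<^sub>k\<close>, \<open>root1 i = \<theta>\<^sub>i\<close>, \<open>coord i j k = m\<^sup>j\<^sub>i\<^sub>,\<^sub>k\<close>.\<close>

record 'a datum =
  rk :: "nat \<Rightarrow> nat"
  gen :: "nat \<Rightarrow> nat \<Rightarrow> 'a \<Rightarrow> 'a"
  word :: "nat \<Rightarrow> nat \<Rightarrow> 'a list set"
  per :: "nat \<Rightarrow> nat \<Rightarrow> nat"
  root1 :: "nat \<Rightarrow> complex"
  coord :: "nat \<Rightarrow> nat \<Rightarrow> nat \<Rightarrow> nat"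

definition primitive_root_of_unity :: "nat \<Rightarrow> complex \<Rightarrow> bool" where
  "primitive_root_of_unity q z \<longleftrightarrow> q > 0 \<and> z ^ q = 1 \<and> (\<forall>d. 0 < d \<and> d < q \<longrightarrow> z ^ d \<noteq> 1)"

definition min_num_generators :: "('g, 'b) monoid_scheme \<Rightarrow> nat" where
  "min_num_generators G =
     (LEAST n. \<exists>S. S \<subseteq> carrier G \<and> finite S \<and> card S = n \<and> generate G S = carrier G)"

text \<open>\<open>G = \<langle>g\<^sub>1\<rangle> \<times> \<dots> \<times> \<langle>g\<^sub>s\<rangle>\<close> as an internal direct product (for abelian \<open>G\<close>).\<close>

definition cyclic_decomposition :: "('g, 'b) monoid_scheme \<Rightarrow> nat \<Rightarrow> (nat \<Rightarrow> 'g) \<Rightarrow> bool" where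
  "cyclic_decomposition G s g \<longleftrightarrow>
     (\<forall>k\<in>{1..s}. g k \<in> carrier G) \<and>
     (\<lambda>h. finprod G h {1..s}) \<in> iso (product_group {1..s} (\<lambda>k. subgroup_generated G {g k})) G"

text \<open>The orbits \<open>X\<^sub>i\<close> with \<open>i > t0\<close> have one element; the trivial data there have \<open>s\<^sub>i = 1\<close> by
  convention, although the trivial group needs no generators.\<close>

definition complete_datum ::
  "'a set \<Rightarrow> ('a \<times> 'a \<Rightarrow> 'a \<times> 'a) \<Rightarrow> nat \<Rightarrow> nat \<Rightarrow> (nat \<Rightarrow> 'a set) \<Rightarrow> 'a datum \<Rightarrow> bool" where
  "complete_datum X r t t0 Xs D \<longleftrightarrow>
     (\<forall>i\<in>{1..t0}. let G = perm_group X r (Xs i); s = rk D i in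
        cyclic_decomposition G s (gen D i) \<and>
        s = min_num_generators G \<and>
        (\<forall>k\<in>{1..s}. per D i k = group.ord G (gen D i k)) \<and>
        (\<forall>k. 1 \<le> k \<and> k < s \<longrightarrow> per D i k dvd per D i (Suc k)) \<and>
        (\<forall>k\<in>{1..s}. word D i k \<in> structure_semigroup X r \<and>
                    gen D i k = restrict (sg_act r (word D i k)) (Xs i)) \<and>
        primitive_root_of_unity (per D i s) (root1 D i) \<and>
        (\<forall>j\<in>{1..t}.
           (\<forall>k\<in>{1..s}. coord D i j k < per D i k) \<and>
           sigma r Xs i j = (\<Otimes>\<^bsub>G\<^esub>k\<in>{1..s}. gen D i k [^]\<^bsub>G\<^esub> coord D i j k))) \<and>
     (\<forall>i\<in>{t0<..t}.
        rk D i = 1 \<and> gen D i 1 = \<one>\<^bsub>perm_group X r (Xs i)\<^esub> \<and> per D i 1 = 1 \<and> root1 D i = 1 \<and>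
        (\<forall>j\<in>{1..t}. coord D i j 1 = 0))"

definition theta :: "'a datum \<Rightarrow> nat \<Rightarrow> nat \<Rightarrow> complex" where
  "theta D i k = root1 D i ^ (per D i (rk D i) div per D i k)"

definition Lam :: "'a datum \<Rightarrow> nat \<Rightarrow> (nat \<Rightarrow> nat) set" where
  "Lam D i = (\<Pi>\<^sub>E k\<in>{1..rk D i}. {0..per D i k - 1})"

definition complex_units :: "complex monoid" where
  "complex_units = \<lparr>carrier = - {0}, mult = (*), one = 1\<rparr>"

text \<open>The extensionality condition only makes the character unique as a HOL function.\<close>

definition chi ::
  "'a set \<Rightarrow> ('a \<times> 'a \<Rightarrow> 'a \<times> 'a) \<Rightarrow> (nat \<Rightarrow> 'a set) \<Rightarrow> 'a datum \<Rightarrow>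
   nat \<Rightarrow> (nat \<Rightarrow> nat) \<Rightarrow> ('a \<Rightarrow> 'a) \<Rightarrow> complex" where
  "chi X r Xs D i \<eta> = (THE \<chi>.
     \<chi> \<in> hom (perm_group X r (Xs i)) complex_units \<and>
     \<chi> \<in> extensional (carrier (perm_group X r (Xs i))) \<and>
     (\<forall>k\<in>{1..rk D i}. \<chi> (gen D i k) = theta D i k ^ \<eta> k))"

text \<open>\<open>mu X r Xs D i j \<eta>\<close> is \<open>\<mu>\<^sup>j\<^sub>i\<^sub>,\<^sub>\<eta> = \<chi>\<^sub>\<eta>(\<sigma>\<^sup>j\<^sub>i)\<close>.\<close>

definition mu ::
  "'a set \<Rightarrow> ('a \<times> 'a \<Rightarrow> 'a \<times> 'a) \<Rightarrow> (nat \<Rightarrow> 'a set) \<Rightarrow> 'a datum \<Rightarrow>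
   nat \<Rightarrow> nat \<Rightarrow> (nat \<Rightarrow> nat) \<Rightarrow> complex" where
  "mu X r Xs D i j \<eta> = chi X r Xs D i \<eta> (sigma r Xs i j)"

section \<open>Linearization\<close>

text \<open>Vectors are complex-valued functions with pointwise operations. For finite \<open>X\<close>, the space
  \<open>\<complex>X\<close> consists of the functions supported on \<open>X\<close>, and \<open>\<complex>X \<otimes> \<complex>X\<close> of the functions supported on
  \<open>X \<times> X\<close>, where \<open>x \<otimes> y\<close> is the basis vector of the pair \<open>(x, y)\<close>.\<close>

definition cscale :: "complex \<Rightarrow> ('b \<Rightarrow> complex) \<Rightarrow> 'b \<Rightarrow> complex" where
  "cscale c v = (\<lambda>b. c * v b)"

global_interpretation cvec: vector_space "cscale :: complex \<Rightarrow> ('b \<Rightarrow> complex) \<Rightarrow> 'b \<Rightarrow> complex"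
  by unfold_locales (auto simp: cscale_def fun_eq_iff algebra_simps)

definition basis_vec :: "'b \<Rightarrow> 'b \<Rightarrow> complex" where
  "basis_vec x = (\<lambda>b. if b = x then 1 else 0)"

definition free_space :: "'b set \<Rightarrow> ('b \<Rightarrow> complex) set" where
  "free_space A = cvec.span (basis_vec ` A)"

definition tensor :: "('a \<Rightarrow> complex) \<Rightarrow> ('a \<Rightarrow> complex) \<Rightarrow> 'a \<times> 'a \<Rightarrow> complex" where
  "tensor v w = (\<lambda>(x, y). v x * w y)"

definition lin_ext ::
  "'a set \<Rightarrow> ('a \<times> 'a \<Rightarrow> 'a \<times> 'a) \<Rightarrow> ('a \<times> 'a \<Rightarrow> complex) \<Rightarrow> 'a \<times> 'a \<Rightarrow> complex" where
  "lin_ext X r F = (\<Sum>q\<in>X \<times> X. cscale (F q) (basis_vec (r q)))"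

lemma tensor_basis_vec: "tensor (basis_vec x) (basis_vec y) = basis_vec (x, y)"
  by (auto simp: tensor_def basis_vec_def fun_eq_iff)

lemma lin_ext_linear: "Vector_Spaces.linear cscale cscale (lin_ext X r)"
  by unfold_locales
    (simp_all add: lin_ext_def cvec.scale_left_distrib sum.distrib cvec.scale_sum_right,
     simp add: cscale_def mult.assoc)

lemma lin_ext_basis:
  assumes "finite X" "x \<in> X" "y \<in> X"
  shows "lin_ext X r (tensor (basis_vec x) (basis_vec y)) =
         tensor (basis_vec (lact r x y)) (basis_vec (ract r y x))"
proof -
  have "lin_ext X r (basis_vec (x, y)) =
        (\<Sum>q\<in>X \<times> X. if q = (x, y) then basis_vec (r q) else 0)"
    unfolding lin_ext_def
    by (rule sum.cong) (auto simp: basis_vec_def cscale_def fun_eq_iff)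
  also have "\<dots> = basis_vec (r (x, y))"
    using assms by (simp add: sum.delta)
  finally show ?thesis
    by (simp add: tensor_basis_vec lact_def ract_def)
qed

text \<open>\<open>yvec X r Xs D b i \<eta>\<close> is \<open>y\<^sup>i\<^sub>\<eta>\<close>; \<open>b i\<close> is the chosen base point \<open>x\<^sub>i\<^sub>1\<close> of \<open>X\<^sub>i\<close>.\<close>

definition yvec ::
  "'a set \<Rightarrow> ('a \<times> 'a \<Rightarrow> 'a \<times> 'a) \<Rightarrow> (nat \<Rightarrow> 'a set) \<Rightarrow> 'a datum \<Rightarrow> (nat \<Rightarrow> 'a) \<Rightarrow>
   nat \<Rightarrow> (nat \<Rightarrow> nat) \<Rightarrow> 'a \<Rightarrow> complex" where
  "yvec X r Xs D b i \<eta> = (\<Sum>\<pi>\<in>carrier (perm_group X r (Xs i)).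
     cscale (chi X r Xs D i \<eta> (inv\<^bsub>perm_group X r (Xs i)\<^esub> \<pi>)) (basis_vec (\<pi> (b i))))"

end

theory Submission
  imports Defs
begin

text \<open>Write \<open>L\<^sub>x\<close> for the left actions and \<open>R\<^sub>y\<close> for the right ones.

  Square-freeness turns multipermutation level two into one identity. The retraction of the
  retraction is a point, so \<open>[L\<^sub>y x]\<close> does not depend on \<open>y\<close>; taking \<open>y = x\<close> gives
  \<open>[L\<^sub>y x] = [x]\<close>, that is, \<open>L\<close> is constant on orbits (\<open>sim_L_self\<close>). Together with involutivity this
  yields \<open>R\<^sub>y x = L\<^sub>y\<^sup>-\<^sup>1 x\<close> (\<open>L_R\<close>), and with the braid relation \<open>L\<^sub>x L\<^sub>y = L\<^sub>y L\<^sub>x\<close> (\<open>L_comm\<close>). So the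
  permutation group \<open>G\<^sub>i\<close> of an orbit \<open>X\<^sub>i\<close> is abelian and transitive, hence regular
  (\<open>orbit_regular\<close>), and on \<open>X\<^sub>j \<times> X\<^sub>i\<close> the map \<open>r\<close> is
  \<open>(u, v) \<mapsto> (\<sigma>\<^sup>j\<^sub>i v, (\<sigma>\<^sup>i\<^sub>j)\<^sup>-\<^sup>1 u)\<close>.

  By regularity \<open>y\<^sup>i\<^sub>\<eta>\<close> is the function on \<open>X\<^sub>i\<close> with value \<open>\<chi>\<^sub>\<eta>(\<pi>)\<^sup>-\<^sup>1\<close> at \<open>\<pi> x\<^sub>i\<^sub>1\<close>. Such a function is a
  simultaneous eigenvector: \<open>y\<^sup>i\<^sub>\<eta>(g v) = \<chi>\<^sub>\<eta>(g)\<^sup>-\<^sup>1 y\<^sup>i\<^sub>\<eta>(v)\<close> (\<open>y_eigenvector\<close>). As \<open>r\<close> is an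
  involution, its linear extension sends a function \<open>F\<close> on \<open>X \<times> X\<close> to \<open>F \<circ> r\<close>
  (\<open>lin_ext_involution\<close>), so the formula for \<open>R\<close> is read off from
  \<open>y\<^sup>i\<^sub>\<eta>(\<sigma>\<^sup>j\<^sub>i v) y\<^sup>j\<^sub>\<zeta>((\<sigma>\<^sup>i\<^sub>j)\<^sup>-\<^sup>1 u)\<close> by pulling out the two eigenvalues (\<open>lin_ext_tensor_y\<close>).

  The cyclic decomposition parametrizes \<open>G\<^sub>i\<close> by exponent vectors (\<open>power_product_bij\<close>). This
  gives the characters \<open>\<chi>\<^sub>\<eta>\<close> (\<open>ex1_character\<close>), their product formula
  (\<open>character_power_product\<close>), and the count \<open>|\<Lambda>\<^sub>i| = |G\<^sub>i| = |X\<^sub>i|\<close>. Distinct labels give distinct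
  characters because \<open>\<theta>\<^sub>i\<^sub>k\<close> has order exactly \<open>p\<^sub>i\<^sub>k\<close>; orthogonality of characters then makes the
  \<open>y\<^sup>i\<^sub>\<eta>\<close> independent, and the count makes them a basis (\<open>y_basis\<close>).\<close>

section \<open>Linear algebra in spaces of complex functions\<close>

lemma sum_apply: "(\<Sum>i\<in>I. f i :: 'b \<Rightarrow> complex) x = (\<Sum>i\<in>I. f i x)"
  by (induction I rule: infinite_finite_induct) auto

text \<open>Pairing with \<open>w i\<close>, evaluated along the sample points \<open>p q\<close>, recovers the \<open>i\<close>-th coefficient of a
  linear combination of the \<open>v j\<close>. For the vectors \<open>y\<^sup>i\<^sub>\<eta>\<close> the samples run along the group: \<open>P\<close> is
  \<open>G\<^sub>i\<close> and \<open>p \<pi>\<close> is \<open>\<pi> x\<^sub>i\<^sub>1\<close>.\<close>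

lemma biorthogonal_imp_independent:
  fixes v :: "'i \<Rightarrow> 'b \<Rightarrow> complex" and N :: complex
  assumes I: "finite I" and N: "N \<noteq> 0"
    and pair: "\<And>i j. i \<in> I \<Longrightarrow> j \<in> I \<Longrightarrow>
      (\<Sum>q\<in>P. w i q * v j (p q)) = (if i = j then N else 0)"
  shows "inj_on v I" and "cvec.independent (v ` I)"
proof -
  show inj: "inj_on v I"
  proof (rule inj_onI, rule ccontr)
    fix i j assume "i \<in> I" "j \<in> I" "v i = v j" "i \<noteq> j"
    then show False
      using pair[of i i] pair[of i j] N by simp
  qed
  show "cvec.independent (v ` I)"
  proof (rule cvec.independent_if_scalars_zero)
    fix c :: "('b \<Rightarrow> complex) \<Rightarrow> complex" and y
    assume zero: "(\<Sum>y\<in>v ` I. cscale (c y) y) = 0" and "y \<in> v ` I"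
    then obtain i where i: "i \<in> I" "y = v i" by blast
    have eval: "(\<Sum>j\<in>I. c (v j) * v j x) = 0" for x
    proof -
      have "(\<Sum>y\<in>v ` I. cscale (c y) y) x = (\<Sum>j\<in>I. c (v j) * v j x)"
        by (simp add: sum.reindex[OF inj] cscale_def sum_apply)
      then show ?thesis using zero by simp
    qed
    have "0 = (\<Sum>q\<in>P. w i q * (\<Sum>j\<in>I. c (v j) * v j (p q)))"
      by (simp add: eval)
    also have "\<dots> = (\<Sum>j\<in>I. c (v j) * (\<Sum>q\<in>P. w i q * v j (p q)))"
      unfolding sum_distrib_left by (subst sum.swap) (simp add: mult_ac)
    also have "\<dots> = (\<Sum>j\<in>I. if i = j then c (v j) * N else 0)"
      by (rule sum.cong) (auto simp: pair i)
    also have "\<dots> = c y * N"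
      using I i by simp
    finally show "c y = 0" using N by simp
  qed (use I in simp)
qed

text \<open>A vector of \<open>T\<close> outside the span of \<open>S\<close> could be added to \<open>S\<close>, giving an independent set in the
  span of \<open>T\<close> with more than \<open>card T\<close> elements.\<close>

lemma independent_card_imp_span_eq:
  fixes S T :: "('b \<Rightarrow> complex) set"
  assumes "finite T" "cvec.independent S" "S \<subseteq> cvec.span T" "card T \<le> card S"
  shows "cvec.span S = cvec.span T"
proof
  show "cvec.span S \<subseteq> cvec.span T"
    using assms(3) by (simp add: cvec.span_minimal)
  have "x \<in> cvec.span S" if "x \<in> T" for x
  proof (rule ccontr)
    assume nx: "x \<notin> cvec.span S"
    then have "cvec.independent (insert x S)"
      by (rule cvec.independent_insertI) (rule assms(2))
    moreover have "insert x S \<subseteq> cvec.span T"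
      using assms(3) cvec.span_base[OF that] by blast
    ultimately have "finite (insert x S) \<and> card (insert x S) \<le> card T"
      by (rule cvec.independent_span_bound[OF assms(1)])
    moreover have "x \<notin> S" using nx cvec.span_base[of x S] by metis
    ultimately show False using assms(4) by (auto simp: card_insert_disjoint)
  qed
  then show "cvec.span T \<subseteq> cvec.span S"
    by (intro cvec.span_minimal cvec.subspace_span subsetI)
qed

text \<open>The coefficient of \<open>r p\<close> in the image of \<open>F\<close> is \<open>F p\<close>, and \<open>p = r (r p)\<close>. Reading the linear
  extension as a pullback makes pointwise computation possible.\<close>

lemma lin_ext_involution:
  assumes fin: "finite X" and clo: "\<And>q. q \<in> X \<times> X \<Longrightarrow> r q \<in> X \<times> X"
    and inv: "\<And>q. q \<in> X \<times> X \<Longrightarrow> r (r q) = q"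
  shows "lin_ext X r F q = (if q \<in> X \<times> X then F (r q) else 0)"
proof -
  have "lin_ext X r F q = (\<Sum>p\<in>X \<times> X. F p * (if q = r p then 1 else 0))"
    by (simp add: lin_ext_def sum_apply cscale_def basis_vec_def)
  also have "\<dots> = (\<Sum>p\<in>X \<times> X. if p = r q then if q \<in> X \<times> X then F p else 0 else 0)"
  proof (rule sum.cong[OF refl])
    fix p assume p: "p \<in> X \<times> X"
    show "F p * (if q = r p then 1 else 0) = (if p = r q then if q \<in> X \<times> X then F p else 0 else 0)"
    proof (cases "q = r p")
      case True
      then show ?thesis using clo[OF p] inv[OF p] by simp
    next
      case False
      then have "q \<notin> X \<times> X" if "p = r q" using inv[of q] that by auto
      then show ?thesis using False by simp
    qed
  qed
  also have "\<dots> = (if q \<in> X \<times> X then F (r q) else 0)"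
    using fin clo[of q] by (simp add: sum.delta)
  finally show ?thesis .
qed

section \<open>Characters of finite abelian groups\<close>

text \<open>Cancelling the smaller power leaves \<open>z ^ (d - c) = 1\<close> with \<open>d - c < n\<close>.\<close>

lemma primitive_root_pow_inj:
  assumes z: "primitive_root_of_unity n z" and "a < n" "b < n" "z ^ a = z ^ b"
  shows "a = b"
proof -
  have "z \<noteq> 0" using z by (auto simp: primitive_root_of_unity_def power_0_left split: if_splits)
  have *: "c = d" if "c \<le> d" "d < n" "z ^ c = z ^ d" for c d
  proof (rule ccontr)
    assume "c \<noteq> d"
    have "z ^ c * z ^ (d - c) = z ^ d"
      using that(1) by (simp flip: power_add)
    then have "z ^ c * z ^ (d - c) = z ^ c * 1"
      using that(3) by simp
    then have "z ^ (d - c) = 1" using \<open>z \<noteq> 0\<close> by (simp only: mult_cancel_left power_eq_0_iff) simp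
    moreover have "0 < d - c" "d - c < n" using that \<open>c \<noteq> d\<close> by auto
    ultimately show False using z by (simp add: primitive_root_of_unity_def)
  qed
  show ?thesis
    using *[of a b] *[of b a] assms by (metis nat_le_linear)
qed

lemma character_nonzero: "\<chi> \<in> hom G complex_units \<Longrightarrow> x \<in> carrier G \<Longrightarrow> \<chi> x \<noteq> 0"
  by (auto simp: hom_def complex_units_def Pi_iff)

lemma character_mult:
  "\<chi> \<in> hom G complex_units \<Longrightarrow> x \<in> carrier G \<Longrightarrow> y \<in> carrier G \<Longrightarrow> \<chi> (x \<otimes>\<^bsub>G\<^esub> y) = \<chi> x * \<chi> y"
  by (auto simp: hom_def complex_units_def)

context group
begin

lemma character_one:
  assumes "\<chi> \<in> hom G complex_units"
  shows "\<chi> \<one> = 1"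
  using character_mult[OF assms, of \<one> \<one>] character_nonzero[OF assms, of \<one>] by simp

lemma character_inv:
  assumes "\<chi> \<in> hom G complex_units" "x \<in> carrier G"
  shows "\<chi> (inv x) = inverse (\<chi> x)"
proof (rule inverse_unique[symmetric])
  show "\<chi> x * \<chi> (inv x) = 1"
    using assms by (simp flip: character_mult[OF assms(1)] add: character_one)
qed

lemma character_pow:
  assumes "\<chi> \<in> hom G complex_units" "x \<in> carrier G"
  shows "\<chi> (x [^] (n::nat)) = \<chi> x ^ n"
  by (induction n) (simp_all add: assms character_one character_mult[OF assms(1)] mult.commute)

text \<open>Translating the summation variable by \<open>g\<close> multiplies the sum by \<open>\<chi> g / \<psi> g\<close>, which is not \<open>1\<close>.\<close>

lemma character_orthogonality:
  assumes chi: "\<chi> \<in> hom G complex_units" and psi: "\<psi> \<in> hom G complex_units"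
    and g: "g \<in> carrier G" "\<chi> g \<noteq> \<psi> g"
  shows "(\<Sum>x\<in>carrier G. \<chi> x * \<psi> (inv x)) = 0"
proof -
  let ?S = "\<Sum>x\<in>carrier G. \<chi> x * \<psi> (inv x)"
  have "bij_betw (\<lambda>x. g \<otimes> x) (carrier G) (carrier G)"
    using g(1) by (intro bij_betwI[where g = "\<lambda>x. inv g \<otimes> x"]) (auto simp: m_assoc[symmetric])
  then have "?S = (\<Sum>x\<in>carrier G. \<chi> (g \<otimes> x) * \<psi> (inv (g \<otimes> x)))"
    by (rule sum.reindex_bij_betw[symmetric])
  also have "\<dots> = (\<Sum>x\<in>carrier G. (\<chi> g / \<psi> g) * (\<chi> x * \<psi> (inv x)))"
    by (rule sum.cong)
      (simp_all add: g character_inv[OF psi] character_mult[OF chi] character_mult[OF psi] field_simps)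
  also have "\<dots> = (\<chi> g / \<psi> g) * ?S"
    by (rule sum_distrib_left[symmetric])
  finally have "(\<chi> g / \<psi> g - 1) * ?S = 0"
    by (simp add: left_diff_distrib)
  moreover have "\<chi> g / \<psi> g \<noteq> 1"
    using g character_nonzero[OF psi g(1)] by (simp add: divide_eq_1_iff)
  ultimately show ?thesis by (metis mult_eq_0_iff right_minus_eq)
qed

end

text \<open>A finite abelian group with an internal decomposition into cyclic subgroups. Its elements are
  handled through exponent vectors, on which multiplication is addition.\<close>

locale cyclic_product = comm_group G for G (structure) +
  fixes s :: nat and g :: "nat \<Rightarrow> 'a"
  assumes fin: "finite (carrier G)"
    and dec: "cyclic_decomposition G s g"
begin

definition power_product :: "(nat \<Rightarrow> nat) \<Rightarrow> 'a" where
  "power_product a = (\<Otimes>k\<in>{1..s}. g k [^] a k)"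

lemma g_closed [simp]: "k \<in> {1..s} \<Longrightarrow> g k \<in> carrier G"
  using dec by (simp add: cyclic_decomposition_def)

lemma ord_pos: "k \<in> {1..s} \<Longrightarrow> 0 < ord (g k)"
  using ord_ge_1[OF fin g_closed[of k]] by linarith

lemma pow_eq_iff_mod_eq:
  assumes "k \<in> {1..s}"
  shows "g k [^] (m::nat) = g k [^] (n::nat) \<longleftrightarrow> m mod ord (g k) = n mod ord (g k)"
proof -
  have "g k [^] m = g k [^] n \<longleftrightarrow> int (ord (g k)) dvd int n - int m"
    using int_pow_eq[OF g_closed[OF assms], of "int m" "int n"] by (simp add: int_pow_int)
  also have "\<dots> \<longleftrightarrow> int n mod int (ord (g k)) = int m mod int (ord (g k))"
    by (rule mod_eq_dvd_iff[symmetric])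
  also have "\<dots> \<longleftrightarrow> m mod ord (g k) = n mod ord (g k)"
    by (auto simp flip: zmod_int)
  finally show ?thesis .
qed

lemma power_product_closed [simp]: "power_product a \<in> carrier G"
  unfolding power_product_def by (rule finprod_closed) auto

lemma carrier_cyclic:
  assumes "k \<in> {1..s}"
  shows "carrier (subgroup_generated G {g k}) = range (\<lambda>n::nat. g k [^] n)"
  using generate_pow_on_finite_carrier[OF fin g_closed[OF assms]] g_closed[OF assms]
  by (auto simp: carrier_subgroup_generated)

text \<open>The decomposition isomorphism, as a bijection, with the cyclic factors written as sets of powers
  with natural exponents, which is possible in a finite group.\<close>

lemma finprod_bij:
  "bij_betw (\<lambda>h. finprod G h {1..s}) (\<Pi>\<^sub>E k\<in>{1..s}. range (\<lambda>n::nat. g k [^] n)) (carrier G)"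
proof -
  have "bij_betw (\<lambda>h. finprod G h {1..s})
      (carrier (product_group {1..s} (\<lambda>k. subgroup_generated G {g k}))) (carrier G)"
    using dec by (simp add: cyclic_decomposition_def iso_def)
  moreover have "carrier (product_group {1..s} (\<lambda>k. subgroup_generated G {g k})) =
      (\<Pi>\<^sub>E k\<in>{1..s}. range (\<lambda>n::nat. g k [^] n))"
    unfolding carrier_product_group by (rule PiE_cong) (rule carrier_cyclic)
  ultimately show ?thesis by simp
qed

lemma power_product_restrict:
  "power_product a = finprod G (\<lambda>k\<in>{1..s}. g k [^] a k) {1..s}"
  unfolding power_product_def by (rule finprod_cong') auto

text \<open>Exponent vectors are not unique, but the powers they produce in each factor are. This is what
  makes functions of exponents well defined on the group.\<close>

lemma power_product_eqD:
  assumes "power_product a = power_product b" "k \<in> {1..s}"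
  shows "g k [^] a k = g k [^] b k"
proof -
  have "(\<lambda>k\<in>{1..s}. g k [^] a k) = (\<lambda>k\<in>{1..s}. g k [^] b k)"
    by (rule inj_onD[OF bij_betw_imp_inj_on[OF finprod_bij]])
      (use assms(1) in \<open>auto simp: power_product_restrict\<close>)
  from fun_cong[OF this, of k] assms(2) show ?thesis by simp
qed

lemma power_product_surj:
  assumes "x \<in> carrier G"
  obtains a where "x = power_product a"
proof -
  obtain h where h: "h \<in> (\<Pi>\<^sub>E k\<in>{1..s}. range (\<lambda>n::nat. g k [^] n))" "x = finprod G h {1..s}"
    using assms bij_betw_imp_surj_on[OF finprod_bij] by blast
  then have "\<forall>k\<in>{1..s}. \<exists>n::nat. h k = g k [^] n"
    by (auto simp: PiE_iff)
  then obtain a :: "nat \<Rightarrow> nat" where a: "\<forall>k\<in>{1..s}. h k = g k [^] a k"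
    by metis
  have "x = power_product a"
    unfolding power_product_def h(2) by (rule finprod_cong') (use a in auto)
  then show thesis by (rule that)
qed

lemma power_product_bij:
  "bij_betw power_product (\<Pi>\<^sub>E k\<in>{1..s}. {..<ord (g k)}) (carrier G)"
proof (rule bij_betw_imageI)
  show "inj_on power_product (\<Pi>\<^sub>E k\<in>{1..s}. {..<ord (g k)})"
  proof (rule inj_onI)
    fix a b assume a: "a \<in> (\<Pi>\<^sub>E k\<in>{1..s}. {..<ord (g k)})"
      and b: "b \<in> (\<Pi>\<^sub>E k\<in>{1..s}. {..<ord (g k)})" and eq: "power_product a = power_product b"
    show "a = b"
    proof (rule PiE_ext[OF a b])
      fix k assume k: "k \<in> {1..s}"
      have "a k < ord (g k)" "b k < ord (g k)"
        using PiE_mem[OF a k] PiE_mem[OF b k] by simp_all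
      then show "a k = b k"
        using power_product_eqD[OF eq k] by (simp add: pow_eq_iff_mod_eq[OF k])
    qed
  qed
  show "power_product ` (\<Pi>\<^sub>E k\<in>{1..s}. {..<ord (g k)}) = carrier G"
  proof (intro equalityI subsetI)
    fix x assume "x \<in> carrier G"
    then obtain a where a: "x = power_product a" by (rule power_product_surj)
    let ?b = "\<lambda>k\<in>{1..s}. a k mod ord (g k)"
    have "x = power_product ?b"
      unfolding a power_product_def
      by (rule finprod_cong') (auto simp: pow_eq_iff_mod_eq)
    moreover have "?b \<in> (\<Pi>\<^sub>E k\<in>{1..s}. {..<ord (g k)})"
      using ord_pos by auto
    ultimately show "x \<in> power_product ` (\<Pi>\<^sub>E k\<in>{1..s}. {..<ord (g k)})" by blast
  qed auto
qed

lemma character_power_product: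
  assumes "\<chi> \<in> hom G complex_units"
  shows "\<chi> (power_product a) = (\<Prod>k\<in>{1..s}. \<chi> (g k) ^ a k)"
proof -
  have "\<chi> (\<Otimes>k\<in>I. g k [^] a k) = (\<Prod>k\<in>I. \<chi> (g k) ^ a k)" if "finite I" "I \<subseteq> {1..s}" for I
    using that
  proof (induction I rule: finite_induct)
    case (insert k I)
    then have "g j \<in> carrier G" if "j \<in> insert k I" for j
      using that by (intro g_closed) auto
    with insert show ?case
      by (simp add: Pi_iff character_mult[OF assms] character_pow[OF assms])
  qed (simp add: character_one assms)
  from this[of "{1..s}"] show ?thesis by (simp add: power_product_def)
qed

text \<open>The value on an element is the product of the \<open>\<omega> k\<close> raised to any exponent vector of it. Two
  exponents giving the same power of \<open>g k\<close> are congruent modulo the order of \<open>g k\<close>, so they give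
  the same power of \<open>\<omega> k\<close>.\<close>

lemma ex1_character:
  assumes \<omega>: "\<And>k. k \<in> {1..s} \<Longrightarrow> \<omega> k ^ ord (g k) = 1"
  shows "\<exists>!\<chi>. \<chi> \<in> hom G complex_units \<and> \<chi> \<in> extensional (carrier G) \<and>
           (\<forall>k\<in>{1..s}. \<chi> (g k) = \<omega> k)"
proof (rule ex_ex1I)
  define expo where "expo x = (SOME a. x = power_product a)" for x
  have expo: "power_product (expo x) = x" if "x \<in> carrier G" for x
    using power_product_surj[OF that] unfolding expo_def by (metis (mono_tags, lifting) someI_ex)
  define \<chi> where "\<chi> = (\<lambda>x\<in>carrier G. \<Prod>k\<in>{1..s}. \<omega> k ^ expo x k)"
  have \<omega>_pow: "\<omega> k ^ m = \<omega> k ^ n" if "k \<in> {1..s}" "g k [^] m = g k [^] n" for k m n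
  proof -
    have *: "\<omega> k ^ j = \<omega> k ^ (j mod ord (g k))" for j
      by (metis \<omega>[OF that(1)] mult_1 mult_div_mod_eq power_add power_mult power_one)
    have "m mod ord (g k) = n mod ord (g k)"
      using that by (simp add: pow_eq_iff_mod_eq)
    then show ?thesis using *[of m] *[of n] by simp
  qed
  have \<chi>_val: "\<chi> (power_product a) = (\<Prod>k\<in>{1..s}. \<omega> k ^ a k)" for a
  proof -
    have "\<omega> k ^ expo (power_product a) k = \<omega> k ^ a k" if "k \<in> {1..s}" for k
      by (rule \<omega>_pow[OF that power_product_eqD[OF _ that]]) (simp add: expo)
    then show ?thesis by (simp add: \<chi>_def)
  qed
  have mult: "power_product a \<otimes> power_product b = power_product (\<lambda>k. a k + b k)" for a b
  proof -
    have "power_product (\<lambda>k. a k + b k) = (\<Otimes>k\<in>{1..s}. g k [^] a k \<otimes> g k [^] b k)"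
      unfolding power_product_def by (rule finprod_cong') (auto simp: nat_pow_mult)
    then show ?thesis
      unfolding power_product_def by (simp add: finprod_multf Pi_iff)
  qed
  have nz: "\<omega> k \<noteq> 0" if "k \<in> {1..s}" for k
  proof
    assume "\<omega> k = 0"
    then show False using \<omega>[OF that] ord_pos[OF that] by (simp add: power_0_left)
  qed
  have "\<chi> \<in> hom G complex_units"
  proof (rule homI)
    fix x assume "x \<in> carrier G"
    then show "\<chi> x \<in> carrier complex_units"
      using nz by (auto simp: \<chi>_def complex_units_def)
  next
    fix x y assume "x \<in> carrier G" "y \<in> carrier G"
    then obtain a b where "x = power_product a" "y = power_product b"
      by (metis power_product_surj)
    then show "\<chi> (x \<otimes> y) = \<chi> x \<otimes>\<^bsub>complex_units\<^esub> \<chi> y"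
      by (simp add: mult \<chi>_val power_add prod.distrib complex_units_def)
  qed
  moreover have "\<chi> (g k) = \<omega> k" if "k \<in> {1..s}" for k
  proof -
    \<comment> \<open>The generator \<open>g k\<close> has the unit vector at \<open>k\<close> as exponent vector.\<close>
    have "power_product (\<lambda>j. if j = k then 1 else 0) = (\<Otimes>j\<in>{1..s}. if k = j then g j else \<one>)"
      unfolding power_product_def by (rule finprod_cong') (auto simp: that)
    also have "\<dots> = g k"
      by (rule finprod_singleton) (use that in auto)
    finally have "\<chi> (g k) = (\<Prod>j\<in>{1..s}. \<omega> j ^ (if j = k then 1 else 0))"
      by (metis \<chi>_val)
    also have "\<dots> = (\<Prod>j\<in>{1..s}. if j = k then \<omega> j else 1)"
      by (rule prod.cong) auto
    finally show ?thesis using that by simp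
  qed
  ultimately show "\<exists>\<chi>. \<chi> \<in> hom G complex_units \<and> \<chi> \<in> extensional (carrier G) \<and>
           (\<forall>k\<in>{1..s}. \<chi> (g k) = \<omega> k)"
    by (auto simp: \<chi>_def)
next
  fix \<chi> \<psi>
  assume *: "\<chi> \<in> hom G complex_units \<and> \<chi> \<in> extensional (carrier G) \<and> (\<forall>k\<in>{1..s}. \<chi> (g k) = \<omega> k)"
    "\<psi> \<in> hom G complex_units \<and> \<psi> \<in> extensional (carrier G) \<and> (\<forall>k\<in>{1..s}. \<psi> (g k) = \<omega> k)"
  show "\<chi> = \<psi>"
  proof (rule extensionalityI)
    fix x assume "x \<in> carrier G"
    then obtain a where "x = power_product a" by (rule power_product_surj)
    then show "\<chi> x = \<psi> x"
      using * by (simp add: character_power_product)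
  qed (use * in auto)
qed

end

text \<open>On a one-element orbit the datum prescribes one trivial generator. This is again a cyclic
  decomposition, so these orbits can be treated like all others.\<close>

lemma trivial_cyclic_decomposition:
  assumes "group K" "carrier K = {\<one>\<^bsub>K\<^esub>}" "g 1 = \<one>\<^bsub>K\<^esub>"
  shows "cyclic_decomposition K 1 g"
proof -
  interpret comm_group K
    using assms(1,2) by (intro group.group_comm_groupI) auto
  let ?P = "product_group {1..1::nat} (\<lambda>k. subgroup_generated K {g k})"
  have cyc: "carrier (subgroup_generated K {g k}) = {\<one>\<^bsub>K\<^esub>}" for k
    using carrier_subgroup_generated_subset[of "{g k}"] assms(2)
      monoid.one_closed[OF group.is_monoid[OF group_subgroup_generated[of "{g k}"]]] by auto
  then have P: "carrier ?P = {\<lambda>k\<in>{1}. \<one>\<^bsub>K\<^esub>}"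
    by (simp add: PiE_eq_singleton)
  have fp: "finprod K h {1..1::nat} = \<one>\<^bsub>K\<^esub>" if "h \<in> {1} \<rightarrow> carrier K" for h
    using that assms(2) by (intro finprod_one_eqI) auto
  have "(\<lambda>h. finprod K h {1..1}) \<in> iso ?P K"
  proof (rule isoI)
    show "bij_betw (\<lambda>h. finprod K h {1..1}) (carrier ?P) (carrier K)"
      unfolding P assms(2) using fp[of "\<lambda>k\<in>{1}. \<one>\<^bsub>K\<^esub>"] by (simp add: bij_betw_def)
    show "(\<lambda>h. finprod K h {1..1}) \<in> hom ?P K"
      unfolding hom_def P using fp[of "\<lambda>k\<in>{1}. \<one>\<^bsub>K\<^esub>"] fp[of "\<lambda>k\<in>{1}. \<one>\<^bsub>K\<^esub> \<otimes>\<^bsub>K\<^esub> \<one>\<^bsub>K\<^esub>"]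
      by (simp cong: restrict_cong)
  qed
  then show ?thesis using assms(3) by (simp add: cyclic_decomposition_def)
qed

section \<open>Square-free symmetric sets of multipermutation level two\<close>

locale sqfree_mpl2 =
  fixes X :: "'a set" and r :: "'a \<times> 'a \<Rightarrow> 'a \<times> 'a"
  assumes symset: "symmetric_set X r" and nondeg: "nondegenerate X r"
    and sqfree: "square_free X r" and finX: "finite X" and mpl: "mpl_eq_2 X r"
begin

abbreviation L :: "'a \<Rightarrow> 'a \<Rightarrow> 'a" where "L \<equiv> lact r"
abbreviation R :: "'a \<Rightarrow> 'a \<Rightarrow> 'a" where "R \<equiv> ract r"

lemma r_eq: "r (x, y) = (L x y, R y x)"
  by (simp add: lact_def ract_def)

lemma L_bij: "x \<in> X \<Longrightarrow> bij_betw (L x) X X"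
  using nondeg by (simp add: nondegenerate_def)

lemma L_closed [simp]: "x \<in> X \<Longrightarrow> y \<in> X \<Longrightarrow> L x y \<in> X"
  using L_bij bij_betwE by blast

lemma R_closed [simp]: "x \<in> X \<Longrightarrow> y \<in> X \<Longrightarrow> R y x \<in> X"
  using nondeg by (auto simp: nondegenerate_def dest: bij_betwE)

lemma L_inj: "x \<in> X \<Longrightarrow> y \<in> X \<Longrightarrow> z \<in> X \<Longrightarrow> L x y = L x z \<Longrightarrow> y = z"
  using bij_betw_imp_inj_on[OF L_bij[of x]] by (simp add: inj_on_def)

lemma r_involution: "q \<in> X \<times> X \<Longrightarrow> r (r q) = q"
  using symset by (auto simp: symmetric_set_def involutive_def)

text \<open>The first component of \<open>r (r (x, y)) = (x, y)\<close>.\<close>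

lemma L_L_R:
  assumes "x \<in> X" "y \<in> X"
  shows "L (L x y) (R y x) = x"
  using r_involution[of "(x, y)"] assms by (simp add: r_eq)

text \<open>The first component of the braid relation at \<open>(x, y, z)\<close>.\<close>

lemma L_braid:
  assumes "x \<in> X" "y \<in> X" "z \<in> X"
  shows "L x (L y z) = L (L x y) (L (R y x) z)"
proof -
  have "r12 r (r23 r (r12 r (x, y, z))) = r23 r (r12 r (r23 r (x, y, z)))"
    using symset assms by (simp add: symmetric_set_def)
  then show ?thesis
    by (simp add: r12_def r23_def r_eq)
qed

lemma L_idem: "x \<in> X \<Longrightarrow> L x x = x"
  using sqfree by (simp add: square_free_def lact_def)

abbreviation sim :: "('a \<times> 'a) set" where "sim \<equiv> ret_rel X r"

lemma sim_iff: "(x, y) \<in> sim \<longleftrightarrow> x \<in> X \<and> y \<in> X \<and> (\<forall>z\<in>X. L x z = L y z)"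
  by (simp add: ret_rel_def)

lemma sim_L_eq: "(x, y) \<in> sim \<Longrightarrow> z \<in> X \<Longrightarrow> L x z = L y z"
  by (simp add: sim_iff)

lemma sim_equiv: "equiv X sim"
  by (auto simp: equiv_def refl_on_def sym_def trans_def ret_rel_def)

text \<open>The braid relation expresses \<open>L\<^sub>x L\<^sub>a\<close> through \<open>L\<^sub>z\<close> and \<open>R\<^sub>a x\<close>, where \<open>z = L\<^sub>x a\<close>, and \<open>R\<^sub>a x\<close> is the
  preimage of \<open>x\<close> under \<open>L\<^sub>z\<close>. So \<open>L\<^sub>a\<close> depends only on \<open>x\<close> and on \<open>L\<^sub>z\<close>.\<close>

lemma sim_L_reflect:
  assumes x: "x \<in> X" and a: "a \<in> X" "a' \<in> X" and z: "(L x a, L x a') \<in> sim"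
  shows "(a, a') \<in> sim"
proof -
  have R: "R a' x = R a x"
  proof (rule L_inj[of "L x a"])
    have "L (L x a) (R a' x) = L (L x a') (R a' x)"
      using z x a by (simp add: sim_iff)
    then show "L (L x a) (R a' x) = L (L x a) (R a x)"
      using x a by (simp add: L_L_R)
  qed (use x a in simp_all)
  have "L a w = L a' w" if w: "w \<in> X" for w
  proof (rule L_inj[OF x])
    have "L x (L a w) = L (L x a) (L (R a x) w)"
      by (rule L_braid[OF x a(1) w])
    also have "\<dots> = L (L x a') (L (R a x) w)"
      using z x a w by (simp add: sim_iff)
    also have "\<dots> = L x (L a' w)"
      using L_braid[OF x a(2) w] by (simp add: R)
    finally show "L x (L a w) = L x (L a' w)" .
  qed (use x a w in simp_all)
  then show ?thesis using a by (simp add: sim_iff)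
qed

text \<open>The converse of \<open>sim_L_reflect\<close>, by counting: the set \<open>P\<close> of pairs that \<open>L\<^sub>x\<close> sends into the
  finite relation \<open>sim\<close> lies in \<open>sim\<close> and is mapped bijectively onto \<open>sim\<close>, so it is all of \<open>sim\<close>.\<close>

lemma sim_L:
  assumes x: "x \<in> X" and "(a, a') \<in> sim"
  shows "(L x a, L x a') \<in> sim"
proof -
  define P where "P = {(a, a'). a \<in> X \<and> a' \<in> X \<and> (L x a, L x a') \<in> sim}"
  have "P \<subseteq> sim"
    using sim_L_reflect[OF x] by (auto simp: P_def)
  moreover have "finite sim"
    by (rule finite_subset[of _ "X \<times> X"]) (auto simp: ret_rel_def finX)
  moreover have "card P = card sim"
  proof (rule bij_betw_same_card[of "map_prod (L x) (L x)"])
    have "inj_on (map_prod (L x) (L x)) P"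
      by (auto simp: inj_on_def P_def dest: L_inj[OF x])
    moreover have "sim \<subseteq> map_prod (L x) (L x) ` P"
    proof
      fix q assume q: "q \<in> sim"
      then obtain u v where uv: "q = (u, v)" "u \<in> X" "v \<in> X" 
        by (auto simp: ret_rel_def)
      then obtain a b where "a \<in> X" "b \<in> X" "u = L x a" "v = L x b"
        using bij_betw_imp_surj_on[OF L_bij[OF x]] by (metis imageE)
      with uv q show "q \<in> map_prod (L x) (L x) ` P"
        by (auto simp: P_def intro!: image_eqI[of _ _ "(a, b)"])
    qed
    moreover have "map_prod (L x) (L x) ` P \<subseteq> sim"
      by (auto simp: P_def)
    ultimately show "bij_betw (map_prod (L x) (L x)) P sim"
      by (simp add: bij_betw_def subset_antisym)
  qed
  ultimately have "P = sim" by (intro card_subset_eq)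
  with assms show ?thesis by (auto simp: P_def)
qed

text \<open>The induced action on classes is well defined, so the union over representatives in \<open>ret_map\<close>
  collapses to one class.\<close>

lemma ret_map_class:
  assumes "x \<in> X" "y \<in> X"
  shows "lact (ret_map X r) (sim `` {x}) (sim `` {y}) = sim `` {L x y}"
proof -
  have "sim `` {L x' y'} = sim `` {L x y}" if "(x, x') \<in> sim" "(y, y') \<in> sim" for x' y'
  proof -
    have "L x' y' = L x y'" using that by (simp add: sim_iff)
    then have "(L x y, L x' y') \<in> sim" using sim_L[OF assms(1) that(2)] by simp
    then show ?thesis using equiv_class_eq[OF sim_equiv] by metis
  qed
  note eq = this
  have xy: "x \<in> sim `` {x}" "y \<in> sim `` {y}" using assms by (simp_all add: sim_iff)
  then have "(\<Union>x'\<in>sim `` {x}. \<Union>y'\<in>sim `` {y}. sim `` {L x' y'}) =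
      (\<Union>x'\<in>sim `` {x}. \<Union>y'\<in>sim `` {y}. sim `` {L x y})"
    by (intro SUP_cong refl eq) simp_all
  also have "\<dots> = sim `` {L x y}"
    using xy by (metis UN_constant empty_iff)
  finally have "(\<Union>x'\<in>sim `` {x}. \<Union>y'\<in>sim `` {y}. sim `` {L x' y'}) = sim `` {L x y}" .
  then show ?thesis
    by (subst lact_def) (simp only: ret_map_def split fst_conv)
qed

text \<open>All classes act alike on classes since the second retraction is a point, and \<open>[x]\<close> acts on
  itself by \<open>[L\<^sub>x x] = [x]\<close>.\<close>

lemma sim_L_self:
  assumes "x \<in> X" "y \<in> X"
  shows "(L y x, x) \<in> sim"
proof -
  let ?Y = "ret_set X r" and ?rel = "ret_rel (ret_set X r) (ret_map X r)"
  have cls: "sim `` {x} \<in> ?Y" "sim `` {y} \<in> ?Y"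
    using assms by (auto simp: ret_set_def quotientI)
  obtain c where "?Y // ?rel = {c}"
    using mpl by (auto simp: mpl_eq_2_def ret_set_def is_singleton_def)
  moreover have "?rel `` {sim `` {x}} \<in> ?Y // ?rel" "?rel `` {sim `` {y}} \<in> ?Y // ?rel"
    using cls by (auto simp: quotientI)
  ultimately have "?rel `` {sim `` {x}} = ?rel `` {sim `` {y}}" by simp
  moreover have "sim `` {x} \<in> ?rel `` {sim `` {x}}" using cls by (auto simp: ret_rel_def)
  ultimately have "(sim `` {y}, sim `` {x}) \<in> ?rel" by auto
  then have "lact (ret_map X r) (sim `` {y}) (sim `` {x}) =
      lact (ret_map X r) (sim `` {x}) (sim `` {x})"
    using cls by (simp add: ret_rel_def[of ?Y])
  then have "sim `` {L y x} = sim `` {x}"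
    using assms by (simp add: ret_map_class L_idem)
  then show ?thesis
    using assms eq_equiv_class[OF _ sim_equiv] by metis
qed

text \<open>Replace \<open>L\<close> at \<open>L\<^sub>x y\<close> by \<open>L\<close> at \<open>y\<close> in \<open>L_L_R\<close>.\<close>

lemma L_R: 
  assumes "x \<in> X" "y \<in> X"
  shows "L y (R y x) = x"
proof -
  have "L (L x y) (R y x) = L y (R y x)"
    by (rule sim_L_eq[OF sim_L_self]) (use assms in simp_all)
  then show ?thesis by (simp only: L_L_R[OF assms])
qed

text \<open>In the braid relation \<open>L\<^sub>x y\<close> may be replaced by \<open>y\<close>, and \<open>R\<^sub>y x\<close> by \<open>L\<^sub>y (R\<^sub>y x) = x\<close>.\<close>

lemma L_comm:
  assumes "x \<in> X" "y \<in> X" "z \<in> X"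
  shows "L x (L y z) = L y (L x z)"
proof -
  have "L (R y x) z = L (L y (R y x)) z"
    by (rule sim_L_eq[symmetric, OF sim_L_self]) (use assms in simp_all)
  then have "L (R y x) z = L x z" using assms by (simp add: L_R)
  moreover have "L (L x y) w = L y w" if "w \<in> X" for w
    by (rule sim_L_eq[OF sim_L_self]) (use assms that in simp_all)
  ultimately show ?thesis
    using assms L_braid[OF assms] by (metis L_closed)
qed

subsection \<open>Permutation groups of invariant subsets\<close>

definition invariant :: "'a set \<Rightarrow> bool" where
  "invariant A \<longleftrightarrow> A \<subseteq> X \<and> (\<forall>x\<in>X. bij_betw (L x) A A)"

abbreviation PG :: "'a set \<Rightarrow> ('a \<Rightarrow> 'a) monoid" where "PG \<equiv> perm_group X r"

lemma invariant_X: "invariant X"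
  by (simp add: invariant_def L_bij)

lemma restrict_L_Bij: "invariant A \<Longrightarrow> x \<in> X \<Longrightarrow> restrict (L x) A \<in> Bij A"
  by (auto simp: Bij_def invariant_def cong: bij_betw_cong)

lemma carrier_PG:
  assumes "invariant A"
  shows "carrier (PG A) = generate (BijGroup A) ((\<lambda>x. restrict (L x) A) ` X)"
proof -
  have "carrier (BijGroup A) \<inter> (\<lambda>x. restrict (L x) A) ` X = (\<lambda>x. restrict (L x) A) ` X"
    using restrict_L_Bij[OF assms] by (auto simp: BijGroup_def)
  then show ?thesis by (simp add: perm_group_def carrier_subgroup_generated)
qed

lemma PG_gen: "invariant A \<Longrightarrow> x \<in> X \<Longrightarrow> restrict (L x) A \<in> carrier (PG A)"
  by (simp add: carrier_PG generate.incl)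

lemma group_PG: "group (PG A)"
  unfolding perm_group_def by (rule group.group_subgroup_generated[OF group_BijGroup])

lemma PG_Bij:
  assumes "g \<in> carrier (PG A)"
  shows "g \<in> Bij A"
proof -
  have "carrier (PG A) \<subseteq> carrier (BijGroup A)"
    unfolding perm_group_def by (rule group.carrier_subgroup_generated_subset[OF group_BijGroup])
  then show ?thesis using assms by (auto simp: BijGroup_def)
qed

lemma PG_one: "\<one>\<^bsub>PG A\<^esub> = (\<lambda>x\<in>A. x)"
  by (simp add: perm_group_def BijGroup_def)

lemma PG_mult:
  assumes "g \<in> carrier (PG A)" "h \<in> carrier (PG A)"
  shows "g \<otimes>\<^bsub>PG A\<^esub> h = compose A g h"
  using PG_Bij[OF assms(1)] PG_Bij[OF assms(2)] by (simp add: perm_group_def BijGroup_def)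

lemma PG_closed:
  assumes "g \<in> carrier (PG A)" "x \<in> A"
  shows "g x \<in> A"
  using Bij_imp_funcset[OF PG_Bij[OF assms(1)]] assms(2) by auto

lemma PG_mult_apply:
  "g \<in> carrier (PG A) \<Longrightarrow> h \<in> carrier (PG A) \<Longrightarrow> x \<in> A \<Longrightarrow> (g \<otimes>\<^bsub>PG A\<^esub> h) x = g (h x)"
  by (simp add: PG_mult compose_eq)

lemma PG_inv_apply:
  assumes "g \<in> carrier (PG A)" "x \<in> A"
  shows "(inv\<^bsub>PG A\<^esub> g) (g x) = x"
proof -
  interpret group "PG A" by (rule group_PG)
  show ?thesis
    using PG_mult_apply[of "inv\<^bsub>PG A\<^esub> g" A g x] assms by (simp add: PG_one)
qed

lemma PG_eqI:
  "g \<in> carrier (PG A) \<Longrightarrow> h \<in> carrier (PG A) \<Longrightarrow> (\<And>x. x \<in> A \<Longrightarrow> g x = h x) \<Longrightarrow> g = h"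
  by (rule extensionalityI[OF Bij_imp_extensional[OF PG_Bij] Bij_imp_extensional[OF PG_Bij]])

lemma finite_PG:
  assumes "A \<subseteq> X"
  shows "finite (carrier (PG A))"
proof (rule finite_subset)
  show "carrier (PG A) \<subseteq> A \<rightarrow>\<^sub>E A"
    using Bij_imp_extensional[OF PG_Bij] Bij_imp_funcset[OF PG_Bij] by (simp add: PiE_def subset_iff)
  show "finite (A \<rightarrow>\<^sub>E A)"
    using assms finX by (simp add: finite_PiE finite_subset)
qed

lemma PG_induct [consumes 2, case_names one gen inv mult]:
  assumes "g \<in> carrier (PG A)" "invariant A"
    and "P \<one>\<^bsub>PG A\<^esub>"
    and "\<And>x. x \<in> X \<Longrightarrow> P (restrict (L x) A)"
    and "\<And>x. x \<in> X \<Longrightarrow> P (inv\<^bsub>PG A\<^esub> (restrict (L x) A))"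
    and "\<And>g h. g \<in> carrier (PG A) \<Longrightarrow> h \<in> carrier (PG A) \<Longrightarrow> P g \<Longrightarrow> P h \<Longrightarrow> P (g \<otimes>\<^bsub>PG A\<^esub> h)"
  shows "P g"
proof -
  have "g \<in> generate (BijGroup A) ((\<lambda>x. restrict (L x) A) ` X)"
    using assms(1,2) by (simp add: carrier_PG)
  then show ?thesis
  proof (induction rule: generate.induct)
    case one
    then show ?case using assms(3) by (simp add: perm_group_def)
  next
    case (incl h)
    then show ?case using assms(4) by auto
  next
    case (inv h)
    then obtain x where x: "x \<in> X" "h = restrict (L x) A" by auto
    have "inv\<^bsub>BijGroup A\<^esub> h = inv\<^bsub>PG A\<^esub> h"
      using PG_gen[OF assms(2) x(1)] unfolding perm_group_def x(2)
      by (simp add: group.inv_subgroup_generated[OF group_BijGroup])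
    then show ?case using assms(5)[OF x(1)] x(2) by simp
  next
    case (eng h1 h2)
    then have "h1 \<in> carrier (PG A)" "h2 \<in> carrier (PG A)"
      by (simp_all add: carrier_PG[OF assms(2)])
    then have "P (h1 \<otimes>\<^bsub>PG A\<^esub> h2)"
      using assms(6) eng by blast
    then show ?case by (simp add: perm_group_def)
  qed
qed

text \<open>The generators commute by \<open>L_comm\<close>. The elements commuting with a fixed \<open>h\<close> are closed under the
  group operations, so it suffices to check this on generators, first for generators \<open>h\<close> and then
  for arbitrary \<open>h\<close>.\<close>

lemma comm_group_PG:
  assumes A: "invariant A"
  shows "comm_group (PG A)"
proof -
  interpret group "PG A" by (rule group_PG)
  have inv_comm: "inv\<^bsub>PG A\<^esub> g \<otimes>\<^bsub>PG A\<^esub> h = h \<otimes>\<^bsub>PG A\<^esub> inv\<^bsub>PG A\<^esub> g"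
    if "g \<in> carrier (PG A)" "h \<in> carrier (PG A)" "g \<otimes>\<^bsub>PG A\<^esub> h = h \<otimes>\<^bsub>PG A\<^esub> g" for g h
  proof -
    have "inv\<^bsub>PG A\<^esub> g \<otimes>\<^bsub>PG A\<^esub> h = inv\<^bsub>PG A\<^esub> g \<otimes>\<^bsub>PG A\<^esub> (h \<otimes>\<^bsub>PG A\<^esub> g) \<otimes>\<^bsub>PG A\<^esub> inv\<^bsub>PG A\<^esub> g"
      using that(1,2) by (simp add: m_assoc)
    also have "\<dots> = inv\<^bsub>PG A\<^esub> g \<otimes>\<^bsub>PG A\<^esub> (g \<otimes>\<^bsub>PG A\<^esub> h) \<otimes>\<^bsub>PG A\<^esub> inv\<^bsub>PG A\<^esub> g"
      by (simp only: that(3))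
    also have "\<dots> = h \<otimes>\<^bsub>PG A\<^esub> inv\<^bsub>PG A\<^esub> g"
      using that(1,2) by (simp add: m_assoc[symmetric])
    finally show ?thesis .
  qed
  have mult_comm: "(g \<otimes>\<^bsub>PG A\<^esub> g') \<otimes>\<^bsub>PG A\<^esub> h = h \<otimes>\<^bsub>PG A\<^esub> (g \<otimes>\<^bsub>PG A\<^esub> g')"
    if "g \<in> carrier (PG A)" "g' \<in> carrier (PG A)" "h \<in> carrier (PG A)"
      "g \<otimes>\<^bsub>PG A\<^esub> h = h \<otimes>\<^bsub>PG A\<^esub> g" "g' \<otimes>\<^bsub>PG A\<^esub> h = h \<otimes>\<^bsub>PG A\<^esub> g'" for g g' h
    using that(1-3) by (simp add: m_assoc that(5)) (simp add: that(4) flip: m_assoc)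
  have closure: "g \<otimes>\<^bsub>PG A\<^esub> h = h \<otimes>\<^bsub>PG A\<^esub> g"
    if g: "g \<in> carrier (PG A)" and h: "h \<in> carrier (PG A)"
      and gens: "\<And>x. x \<in> X \<Longrightarrow> restrict (L x) A \<otimes>\<^bsub>PG A\<^esub> h = h \<otimes>\<^bsub>PG A\<^esub> restrict (L x) A" for g h
    using g A
  proof (induction rule: PG_induct)
    case one
    show ?case using h by (simp only: l_one r_one)
  next
    case (gen x)
    then show ?case by (rule gens)
  next
    case (inv x)
    show ?case by (rule inv_comm[OF PG_gen[OF A inv] h gens[OF inv]])
  next
    case (mult g g')
    show ?case by (rule mult_comm[OF mult(1,2) h mult(3,4)])
  qed
  have gens: "restrict (L x) A \<otimes>\<^bsub>PG A\<^esub> restrict (L y) A = restrict (L y) A \<otimes>\<^bsub>PG A\<^esub> restrict (L x) A"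
    if xy: "x \<in> X" "y \<in> X" for x y
  proof (rule PG_eqI)
    fix z assume z: "z \<in> A"
    have "L u z \<in> A" if "u \<in> X" for u
      using A that z by (auto simp: invariant_def dest: bij_betwE)
    moreover have "z \<in> X" using A z by (auto simp: invariant_def)
    ultimately show "(restrict (L x) A \<otimes>\<^bsub>PG A\<^esub> restrict (L y) A) z =
        (restrict (L y) A \<otimes>\<^bsub>PG A\<^esub> restrict (L x) A) z"
      using xy z by (simp add: PG_mult_apply PG_gen[OF A] L_comm)
  qed (intro m_closed PG_gen[OF A] xy)+
  show ?thesis
  proof (rule group_comm_groupI)
    fix g h assume g: "g \<in> carrier (PG A)" and h: "h \<in> carrier (PG A)"
    have "h \<otimes>\<^bsub>PG A\<^esub> restrict (L x) A = restrict (L x) A \<otimes>\<^bsub>PG A\<^esub> h" if "x \<in> X" for x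
      by (rule closure[OF h PG_gen[OF A that] gens[OF _ that]])
    then show "g \<otimes>\<^bsub>PG A\<^esub> h = h \<otimes>\<^bsub>PG A\<^esub> g"
      by (intro closure[OF g h]) (rule sym)
  qed
qed


subsection \<open>Orbits\<close>

text \<open>Orbits are defined by the group on \<open>X\<close>, whereas transitivity is needed for the group generated
  by the restrictions to the orbit. Along the generation of \<open>g\<close>, each value \<open>g a\<close> with \<open>a\<close> in the
  orbit is also attained by some element of the smaller group; that element may vary with \<open>a\<close>.
  The same induction propagates \<open>sim_L_self\<close> from one generator to the whole orbit.\<close>

lemma orbit_props:
  assumes "A \<in> perm_orbits X r"
  shows orbit_invariant: "invariant A"
    and orbit_sim: "\<And>x y. x \<in> A \<Longrightarrow> y \<in> A \<Longrightarrow> (x, y) \<in> sim"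
    and orbit_transitive: "\<And>x y. x \<in> A \<Longrightarrow> y \<in> A \<Longrightarrow> \<exists>g\<in>carrier (PG A). g x = y"
proof -
  interpret PX: group "PG X" by (rule group_PG)
  obtain x0 where x0: "x0 \<in> X" and A: "A = {g x0 | g. g \<in> carrier (PG X)}"
    using assms by (auto simp: perm_orbits_def orbits_def orbit_def)
  have AX: "A \<subseteq> X" using A x0 PG_closed by blast
  have L_A: "L x a \<in> A" if x: "x \<in> X" and "a \<in> A" for x a
  proof -
    obtain g where g: "g \<in> carrier (PG X)" "a = g x0" using A \<open>a \<in> A\<close> by blast
    have l: "restrict (L x) X \<in> carrier (PG X)" using PG_gen[OF invariant_X x] .
    have "L x a = (restrict (L x) X \<otimes>\<^bsub>PG X\<^esub> g) x0"
      using PG_mult_apply[OF l g(1) x0] PG_closed[OF g(1) x0] g(2) by simp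
    then show ?thesis using A PX.m_closed[OF l g(1)] by blast
  qed
  show inv: "invariant A"
    unfolding invariant_def
  proof (intro conjI AX ballI)
    fix x assume x: "x \<in> X"
    have inj: "inj_on (L x) A"
      using bij_betw_imp_inj_on[OF L_bij[OF x]] AX by (rule inj_on_subset)
    moreover have "L x ` A = A"
      using L_A[OF x] inj AX finX by (intro endo_inj_surj) (auto intro: finite_subset)
    ultimately show "bij_betw (L x) A A" by (simp add: bij_betw_def)
  qed
  have step: "(a, g a) \<in> sim \<and> g a \<in> A \<and> (\<exists>h\<in>carrier (PG A). h a = g a)"
    if "g \<in> carrier (PG X)" "a \<in> A" for g a
    using that(1) invariant_X that(2)
  proof (induction arbitrary: a rule: PG_induct)
    case one
    then have "a \<in> X" using AX by blast
    moreover have "\<one>\<^bsub>PG A\<^esub> \<in> carrier (PG A)" 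
      by (rule monoid.one_closed[OF group.is_monoid[OF group_PG]])
    ultimately show ?case using one by (auto simp: PG_one sim_iff intro!: bexI[of _ "\<one>\<^bsub>PG A\<^esub>"])
  next
    case (gen x)
    then have "a \<in> X" using AX by blast
    moreover have "(a, L x a) \<in> sim"
      using sim_L_self[OF \<open>a \<in> X\<close> gen(1)] by (simp add: sim_iff)
    ultimately show ?case
      using gen L_A[OF gen] PG_gen[OF inv gen(1)]
      by (auto intro!: bexI[of _ "restrict (L x) A"])
  next
    case (inv x)
    have "L x ` A = A"
      using inv(1) \<open>invariant A\<close> by (simp add: invariant_def bij_betw_def)
    then obtain c where c: "c \<in> A" "L x c = a"
      using inv(2) by (metis imageE)
    then have "c \<in> X" using AX by blast
    have "(inv\<^bsub>PG X\<^esub> restrict (L x) X) a = c"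
      using PG_inv_apply[OF PG_gen[OF invariant_X inv(1)] \<open>c \<in> X\<close>] c \<open>c \<in> X\<close> by simp
    moreover have "(inv\<^bsub>PG A\<^esub> restrict (L x) A) a = c"
      using PG_inv_apply[OF PG_gen[OF \<open>invariant A\<close> inv(1)] c(1)] c by simp
    moreover have "inv\<^bsub>PG A\<^esub> restrict (L x) A \<in> carrier (PG A)"
      by (rule group.inv_closed[OF group_PG PG_gen[OF \<open>invariant A\<close> inv(1)]])
    moreover have "(a, c) \<in> sim"
      using sim_L_self[OF \<open>c \<in> X\<close> inv(1)] c(2) by simp
    ultimately show ?case using c(1) by auto
  next
    case (mult g h)
    obtain k where k: "(a, h a) \<in> sim" "h a \<in> A" "k \<in> carrier (PG A)" "k a = h a"
      using mult(4)[OF mult(5)] by blast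
    obtain l where l: "(h a, g (h a)) \<in> sim" "g (h a) \<in> A" "l \<in> carrier (PG A)" "l (h a) = g (h a)"
      using mult(3)[OF k(2)] by blast
    have "(g \<otimes>\<^bsub>PG X\<^esub> h) a = g (h a)"
      using mult(1,2,5) AX by (intro PG_mult_apply) auto
    moreover have "(l \<otimes>\<^bsub>PG A\<^esub> k) a = g (h a)"
      using PG_mult_apply[OF l(3) k(3) mult(5)] k(4) l(4) by simp
    moreover have "l \<otimes>\<^bsub>PG A\<^esub> k \<in> carrier (PG A)"
      by (rule monoid.m_closed[OF group.is_monoid[OF group_PG] l(3) k(3)])
    moreover have "(a, g (h a)) \<in> sim"
      using k(1) l(1) by (simp add: sim_iff)
    ultimately show ?case using l(2) by auto
  qed
  have orb: "\<exists>g\<in>carrier (PG X). g x = y" if xy: "x \<in> A" "y \<in> A" for x y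
  proof -
    obtain g h where gh: "g \<in> carrier (PG X)" "x = g x0" "h \<in> carrier (PG X)" "y = h x0"
      using A xy by blast
    have "(h \<otimes>\<^bsub>PG X\<^esub> inv\<^bsub>PG X\<^esub> g) x = y"
      using gh x0 PG_closed[OF gh(1) x0] by (simp add: PG_mult_apply PG_inv_apply)
    then show ?thesis using gh by (intro bexI[of _ "h \<otimes>\<^bsub>PG X\<^esub> inv\<^bsub>PG X\<^esub> g"]) auto
  qed
  show "(x, y) \<in> sim" if "x \<in> A" "y \<in> A" for x y
    using orb[OF that] step that(1) by blast
  show "\<exists>g\<in>carrier (PG A). g x = y" if "x \<in> A" "y \<in> A" for x y
    using orb[OF that] step[OF _ that(1)] by metis
qed

lemma orbit_subset: "A \<in> perm_orbits X r \<Longrightarrow> A \<subseteq> X"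
  using orbit_invariant invariant_def by blast

text \<open>An element of a transitive abelian group is determined by its value at one point: the value at
  \<open>k x\<close> is the image under \<open>k\<close> of the value at \<open>x\<close>.\<close>

lemma orbit_regular:
  assumes A: "A \<in> perm_orbits X r" and x: "x \<in> A"
  shows "bij_betw (\<lambda>g. g x) (carrier (PG A)) A"
proof (rule bij_betw_imageI)
  interpret comm_group "PG A"
    by (rule comm_group_PG[OF orbit_invariant[OF A]])
  show "inj_on (\<lambda>g. g x) (carrier (PG A))"
  proof (rule inj_onI, rule PG_eqI)
    fix g h y
    assume gh: "g \<in> carrier (PG A)" "h \<in> carrier (PG A)" "g x = h x" and "y \<in> A"
    then obtain k where k: "k \<in> carrier (PG A)" "k x = y"
      using orbit_transitive[OF A x] by blast
    have "g (k x) = (k \<otimes>\<^bsub>PG A\<^esub> g) x"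
      using gh k x by (simp add: m_comm[of k g] PG_mult_apply)
    also have "\<dots> = (k \<otimes>\<^bsub>PG A\<^esub> h) x"
      using gh k x by (simp add: PG_mult_apply)
    also have "\<dots> = h (k x)"
      using gh k x by (simp add: m_comm[of k h] PG_mult_apply)
    finally show "g y = h y" using k by simp
  qed
  show "(\<lambda>g. g x) ` carrier (PG A) = A"
    using PG_closed[OF _ x] orbit_transitive[OF A x] by blast
qed

end

section \<open>The basis of characters and the linearized solution\<close>

locale sqfree_mpl2_datum = sqfree_mpl2 X r for X :: "'a set" and r +
  fixes t t0 :: nat and Xs :: "nat \<Rightarrow> 'a set" and D :: "'a datum" and b :: "nat \<Rightarrow> 'a"
  assumes enum: "orbit_enum X r t t0 Xs"
    and datum: "complete_datum X r t t0 Xs D"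
    and base: "\<forall>i\<in>{1..t}. b i \<in> Xs i"
begin

abbreviation G :: "nat \<Rightarrow> ('a \<Rightarrow> 'a) monoid" where "G i \<equiv> PG (Xs i)"
abbreviation \<sigma> :: "nat \<Rightarrow> nat \<Rightarrow> 'a \<Rightarrow> 'a" where "\<sigma> \<equiv> sigma r Xs"
abbreviation \<chi> :: "nat \<Rightarrow> (nat \<Rightarrow> nat) \<Rightarrow> ('a \<Rightarrow> 'a) \<Rightarrow> complex" where "\<chi> \<equiv> chi X r Xs D"
abbreviation y :: "nat \<Rightarrow> (nat \<Rightarrow> nat) \<Rightarrow> 'a \<Rightarrow> complex" where "y \<equiv> yvec X r Xs D b"

lemma orb: "i \<in> {1..t} \<Longrightarrow> Xs i \<in> perm_orbits X r"
  using enum by (auto simp: orbit_enum_def dest: bij_betwE)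

lemma comm_G: "i \<in> {1..t} \<Longrightarrow> comm_group (G i)"
  by (intro comm_group_PG orbit_invariant orb)

lemma finite_G: "i \<in> {1..t} \<Longrightarrow> finite (carrier (G i))"
  by (intro finite_PG orbit_subset orb)

lemma sigma_eq:
  assumes "i \<in> {1..t}" "j \<in> {1..t}" "x \<in> Xs j"
  shows "\<sigma> i j = restrict (L x) (Xs i)"
  unfolding sigma_def
proof (rule the_equality)
  show "\<forall>x'\<in>Xs j. restrict (L x) (Xs i) = restrict (L x') (Xs i)"
  proof
    fix x' assume "x' \<in> Xs j"
    then have "(x, x') \<in> sim" using orbit_sim[OF orb[OF assms(2)] assms(3)] by blast
    then show "restrict (L x) (Xs i) = restrict (L x') (Xs i)"
      using orbit_subset[OF orb[OF assms(1)]] by (intro restrict_ext sim_L_eq) auto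
  qed
qed (use assms(3) in blast)

lemma sigma_closed:
  assumes "i \<in> {1..t}" "j \<in> {1..t}"
  shows "\<sigma> i j \<in> carrier (G i)"
proof -
  have bj: "b j \<in> Xs j" using base assms(2) by blast
  then have "b j \<in> X" using orbit_subset[OF orb[OF assms(2)]] by blast
  then show ?thesis
    unfolding sigma_eq[OF assms bj] by (rule PG_gen[OF orbit_invariant[OF orb[OF assms(1)]]])
qed

lemma singleton_orbit_G:
  assumes "i \<in> {t0<..t}"
  shows "carrier (G i) = {\<one>\<^bsub>G i\<^esub>}"
proof -
  have i: "i \<in> {1..t}" using assms by auto
  have "\<not> card (Xs i) > 1" using enum assms i by (force simp: orbit_enum_def)
  moreover have "b i \<in> Xs i" using base i by blast
  moreover have "finite (Xs i)" using orbit_subset[OF orb[OF i]] finX finite_subset by blast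
  ultimately have Xi: "Xs i = {b i}"
    by (metis card_le_Suc0_iff_eq One_nat_def is_singletonI' is_singleton_the_elem not_less
        singletonD empty_iff)
  interpret comm_group "G i" by (rule comm_G[OF i])
  have "g = \<one>\<^bsub>G i\<^esub>" if g: "g \<in> carrier (G i)" for g
  proof (rule PG_eqI[OF g one_closed])
    fix x assume x: "x \<in> Xs i"
    then show "g x = \<one>\<^bsub>G i\<^esub> x"
      using PG_closed[OF g x] PG_closed[OF one_closed x] unfolding Xi by simp
  qed
  then show ?thesis using one_closed by blast
qed

text \<open>One-element orbits and larger ones are specified separately in a complete datum; what the proof
  uses holds for both. The divisibility chain is collapsed to divisibility of the last period.\<close>

lemma datum_G:
  assumes i: "i \<in> {1..t}"
  shows cyclic_product_G: "cyclic_product (G i) (rk D i) (gen D i)"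
    and per_eq: "\<And>k. k \<in> {1..rk D i} \<Longrightarrow> per D i k = group.ord (G i) (gen D i k)"
    and per_dvd: "\<And>k. k \<in> {1..rk D i} \<Longrightarrow> per D i k dvd per D i (rk D i)"
    and root1_primitive: "primitive_root_of_unity (per D i (rk D i)) (root1 D i)"
    and sigma_power_product: "\<And>j. j \<in> {1..t} \<Longrightarrow>
      \<sigma> i j = (\<Otimes>\<^bsub>G i\<^esub>k\<in>{1..rk D i}. gen D i k [^]\<^bsub>G i\<^esub> coord D i j k)"
proof -
  interpret comm_group "G i" by (rule comm_G[OF i])
  have all: "cyclic_decomposition (G i) (rk D i) (gen D i) \<and>
    (\<forall>k\<in>{1..rk D i}. per D i k = ord (gen D i k)) \<and>
    (\<forall>k\<in>{1..rk D i}. per D i k dvd per D i (rk D i)) \<and>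
    primitive_root_of_unity (per D i (rk D i)) (root1 D i) \<and>
    (\<forall>j\<in>{1..t}. \<sigma> i j = (\<Otimes>\<^bsub>G i\<^esub>k\<in>{1..rk D i}. gen D i k [^]\<^bsub>G i\<^esub> coord D i j k))"
  proof (cases "i \<le> t0")
    case True
    then have "i \<in> {1..t0}" using i by simp
    then have d: "cyclic_decomposition (G i) (rk D i) (gen D i)"
      "\<forall>k\<in>{1..rk D i}. per D i k = ord (gen D i k)"
      "\<forall>k. 1 \<le> k \<and> k < rk D i \<longrightarrow> per D i k dvd per D i (Suc k)"
      "primitive_root_of_unity (per D i (rk D i)) (root1 D i)"
      "\<forall>j\<in>{1..t}. \<sigma> i j = (\<Otimes>\<^bsub>G i\<^esub>k\<in>{1..rk D i}. gen D i k [^]\<^bsub>G i\<^esub> coord D i j k)"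
      using datum unfolding complete_datum_def Let_def by blast+
    have "per D i k dvd per D i (rk D i)" if "k \<le> rk D i" "1 \<le> k" for k
      using that
    proof (induction k rule: inc_induct)
      case (step k)
      then show ?case using d(3) dvd_trans by (metis Suc_le_eq le_Suc_eq)
    qed simp
    with d show ?thesis by simp
  next
    case False
    then have i': "i \<in> {t0<..t}" using i by simp
    then have d: "rk D i = 1" "gen D i 1 = \<one>\<^bsub>G i\<^esub>" "per D i 1 = 1" "root1 D i = 1"
      using datum unfolding complete_datum_def by blast+
    have "\<sigma> i j = (\<Otimes>\<^bsub>G i\<^esub>k\<in>{1..rk D i}. gen D i k [^]\<^bsub>G i\<^esub> coord D i j k)" if j: "j \<in> {1..t}" for j
    proof -
      have "(\<Otimes>\<^bsub>G i\<^esub>k\<in>{1..rk D i}. gen D i k [^]\<^bsub>G i\<^esub> coord D i j k) \<in> carrier (G i)"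
        by (rule finprod_closed) (use d in \<open>simp add: Pi_iff\<close>)
      then show ?thesis
        using sigma_closed[OF i j] singleton_orbit_G[OF i'] by auto
    qed
    moreover have "ord \<one>\<^bsub>G i\<^esub> = 1" using ord_eq_1 by blast
    moreover have "cyclic_decomposition (G i) 1 (gen D i)"
      using singleton_orbit_G[OF i'] d(2) by (intro trivial_cyclic_decomposition is_group)
    ultimately show ?thesis
      using d by (auto simp: primitive_root_of_unity_def)
  qed
  then show "cyclic_product (G i) (rk D i) (gen D i)"
    using finite_G[OF i] by unfold_locales simp_all
  show "\<And>k. k \<in> {1..rk D i} \<Longrightarrow> per D i k = ord (gen D i k)"
    "\<And>k. k \<in> {1..rk D i} \<Longrightarrow> per D i k dvd per D i (rk D i)"
    "primitive_root_of_unity (per D i (rk D i)) (root1 D i)"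
    "\<And>j. j \<in> {1..t} \<Longrightarrow> \<sigma> i j = (\<Otimes>\<^bsub>G i\<^esub>k\<in>{1..rk D i}. gen D i k [^]\<^bsub>G i\<^esub> coord D i j k)"
    using all by blast+
qed

lemma per_pos: "i \<in> {1..t} \<Longrightarrow> k \<in> {1..rk D i} \<Longrightarrow> 0 < per D i k"
  using cyclic_product.ord_pos[OF cyclic_product_G[of i]] by (simp add: per_eq)

lemma theta_pow_per:
  assumes "i \<in> {1..t}" "k \<in> {1..rk D i}"
  shows "theta D i k ^ per D i k = 1"
  using root1_primitive[OF assms(1)] per_dvd[OF assms]
  by (simp add: theta_def primitive_root_of_unity_def flip: power_mult)

text \<open>With \<open>q = p\<^sub>i\<^sub>s / p\<^sub>i\<^sub>k\<close>, the powers of \<open>\<theta>\<^sub>i\<^sub>k\<close> below \<open>p\<^sub>i\<^sub>k\<close> are the powers of \<open>\<theta>\<^sub>i\<close> at multiples of \<open>q\<close>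
  below \<open>p\<^sub>i\<^sub>s\<close>.\<close>

lemma theta_pow_inj:
  assumes "i \<in> {1..t}" "k \<in> {1..rk D i}"
    and "m < per D i k" "m' < per D i k" "theta D i k ^ m = theta D i k ^ m'"
  shows "m = m'"
proof -
  let ?q = "per D i (rk D i) div per D i k"
  have n: "per D i (rk D i) = ?q * per D i k" using per_dvd[OF assms(1,2)] by simp
  moreover have "0 < per D i (rk D i)"
    using root1_primitive[OF assms(1)] by (simp add: primitive_root_of_unity_def)
  ultimately have q: "0 < ?q" by (metis nat_0_less_mult_iff)
  have "?q * m < per D i (rk D i)" "?q * m' < per D i (rk D i)"
    using q assms(3,4) n by (metis nat_mult_less_cancel1)+
  moreover have "root1 D i ^ (?q * m) = root1 D i ^ (?q * m')"
    using assms(5) by (simp add: theta_def power_mult)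
  ultimately have "?q * m = ?q * m'"
    by (rule primitive_root_pow_inj[OF root1_primitive[OF assms(1)]])
  then show ?thesis using q by simp
qed

lemma chi_character:
  assumes "i \<in> {1..t}"
  shows chi_hom: "\<chi> i \<eta> \<in> hom (G i) complex_units"
    and chi_gen: "\<And>k. k \<in> {1..rk D i} \<Longrightarrow> \<chi> i \<eta> (gen D i k) = theta D i k ^ \<eta> k"
proof -
  interpret cyclic_product "G i" "rk D i" "gen D i"
    by (rule cyclic_product_G[OF assms])
  have "(theta D i k ^ \<eta> k) ^ ord (gen D i k) = 1" if "k \<in> {1..rk D i}" for k
    using theta_pow_per[OF assms that] per_eq[OF assms that]
    by (metis mult.commute power_mult power_one)
  from theI'[OF ex1_character[OF this]] 
  show "\<chi> i \<eta> \<in> hom (G i) complex_units"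
    "\<And>k. k \<in> {1..rk D i} \<Longrightarrow> \<chi> i \<eta> (gen D i k) = theta D i k ^ \<eta> k"
    unfolding chi_def by blast+
qed

text \<open>The interval \<open>{0..p - 1}\<close> has \<open>p\<close> elements because periods are positive.\<close>

lemma Lam_eq:
  assumes "i \<in> {1..t}"
  shows "Lam D i = (\<Pi>\<^sub>E k\<in>{1..rk D i}. {..<group.ord (G i) (gen D i k)})"
  unfolding Lam_def
proof (rule PiE_cong)
  fix k assume k: "k \<in> {1..rk D i}"
  then show "{0..per D i k - 1} = {..<group.ord (G i) (gen D i k)}"
    using per_pos[OF assms k] by (auto simp flip: per_eq[OF assms k])
qed

lemma chi_distinct:
  assumes "i \<in> {1..t}" "\<eta> \<in> Lam D i" "\<zeta> \<in> Lam D i" "\<eta> \<noteq> \<zeta>"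
  obtains g where "g \<in> carrier (G i)" "\<chi> i \<eta> g \<noteq> \<chi> i \<zeta> g"
proof -
  interpret cyclic_product "G i" "rk D i" "gen D i"
    by (rule cyclic_product_G[OF assms(1)])
  obtain k where k: "k \<in> {1..rk D i}" "\<eta> k \<noteq> \<zeta> k"
    using assms(2-4) PiE_ext unfolding Lam_def by metis
  have "\<eta> k < per D i k" "\<zeta> k < per D i k"
    using assms(2,3) k(1) per_eq[OF assms(1) k(1)] by (auto simp: Lam_eq[OF assms(1)] PiE_iff)
  then have "theta D i k ^ \<eta> k \<noteq> theta D i k ^ \<zeta> k"
    using theta_pow_inj[OF assms(1) k(1)] k(2) by blast
  then show thesis
    using chi_gen[OF assms(1) k(1)] g_closed[OF k(1)] that by metis
qed

text \<open>Both sides count \<open>G\<^sub>i\<close>: labels are exponent vectors, and \<open>G\<^sub>i\<close> is regular on \<open>X\<^sub>i\<close>.\<close>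

lemma card_Lam:
  assumes "i \<in> {1..t}"
  shows "card (Lam D i) = card (Xs i)" and "finite (Lam D i)"
proof -
  interpret cyclic_product "G i" "rk D i" "gen D i"
    by (rule cyclic_product_G[OF assms])
  have "card (Lam D i) = card (carrier (G i))"
    unfolding Lam_eq[OF assms] by (rule bij_betw_same_card[OF power_product_bij])
  also have "\<dots> = card (Xs i)"
    using base assms by (intro bij_betw_same_card[OF orbit_regular[OF orb[OF assms]]]) blast
  finally show "card (Lam D i) = card (Xs i)" .
  show "finite (Lam D i)"
    unfolding Lam_def by (intro finite_PiE) auto
qed

text \<open>By regularity only the summand \<open>\<pi> = \<rho>\<close> contributes at the point \<open>\<rho> x\<^sub>i\<^sub>1\<close>.\<close>

lemma y_apply:
  assumes i: "i \<in> {1..t}" and \<rho>: "\<rho> \<in> carrier (G i)"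
  shows "y i \<eta> (\<rho> (b i)) = \<chi> i \<eta> (inv\<^bsub>G i\<^esub> \<rho>)"
proof -
  have inj: "inj_on (\<lambda>g. g (b i)) (carrier (G i))"
    using base i by (intro bij_betw_imp_inj_on[OF orbit_regular[OF orb[OF i]]]) blast
  have "y i \<eta> (\<rho> (b i)) =
      (\<Sum>\<pi>\<in>carrier (G i). \<chi> i \<eta> (inv\<^bsub>G i\<^esub> \<pi>) * (if \<rho> (b i) = \<pi> (b i) then 1 else 0))"
    by (simp add: yvec_def sum_apply cscale_def basis_vec_def)
  also have "\<dots> = (\<Sum>\<pi>\<in>carrier (G i). if \<pi> = \<rho> then \<chi> i \<eta> (inv\<^bsub>G i\<^esub> \<pi>) else 0)"
    using inj_onD[OF inj _ \<rho>] by (intro sum.cong refl) auto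
  also have "\<dots> = \<chi> i \<eta> (inv\<^bsub>G i\<^esub> \<rho>)"
    using finite_G[OF i] \<rho> by simp
  finally show ?thesis .
qed

lemma y_outside:
  assumes i: "i \<in> {1..t}" and x: "x \<notin> Xs i"
  shows "y i \<eta> x = 0"
proof -
  have "x \<noteq> \<pi> (b i)" if "\<pi> \<in> carrier (G i)" for \<pi>
    using PG_closed[OF that] base i x by blast
  then show ?thesis
    by (simp add: yvec_def sum_apply cscale_def basis_vec_def)
qed

text \<open>The point \<open>x = \<rho> x\<^sub>i\<^sub>1\<close> moves to \<open>(g \<rho>) x\<^sub>i\<^sub>1\<close>, where the value is \<open>\<chi>\<^sub>\<eta>(g \<rho>)\<^sup>-\<^sup>1\<close>.\<close>

lemma y_eigenvector:
  assumes i: "i \<in> {1..t}" and g: "g \<in> carrier (G i)" and x: "x \<in> Xs i"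
  shows "y i \<eta> (g x) = y i \<eta> x / \<chi> i \<eta> g"
proof -
  interpret comm_group "G i" by (rule comm_G[OF i])
  have bi: "b i \<in> Xs i" using base i by blast
  obtain \<rho> where \<rho>: "\<rho> \<in> carrier (G i)" "\<rho> (b i) = x"
    using orbit_transitive[OF orb[OF i] bi x] by blast
  have "g x = (g \<otimes>\<^bsub>G i\<^esub> \<rho>) (b i)"
    using PG_mult_apply[OF g \<rho>(1) bi] \<rho>(2) by simp
  then have "y i \<eta> (g x) = \<chi> i \<eta> (inv\<^bsub>G i\<^esub> (g \<otimes>\<^bsub>G i\<^esub> \<rho>))"
    using y_apply[OF i m_closed[OF g \<rho>(1)]] by simp
  also have "\<dots> = \<chi> i \<eta> (inv\<^bsub>G i\<^esub> \<rho>) / \<chi> i \<eta> g"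
    using g \<rho>(1) by (simp add: character_inv[OF chi_hom[OF i]] character_mult[OF chi_hom[OF i]] divide_inverse)
  also have "\<chi> i \<eta> (inv\<^bsub>G i\<^esub> \<rho>) = y i \<eta> x"
    using y_apply[OF i \<rho>(1)] \<rho>(2) by simp
  finally show ?thesis .
qed

text \<open>The values \<open>\<chi>\<^sub>\<eta>(\<pi>)\<close> are dual to the \<open>y\<^sup>i\<^sub>\<zeta>\<close> up to the factor \<open>|G\<^sub>i|\<close> by orthogonality, which gives
  injectivity and independence; the span is full because there are \<open>|X\<^sub>i|\<close> labels.\<close>

lemma y_basis:
  assumes i: "i \<in> {1..t}"
  shows y_inj: "inj_on (y i) (Lam D i)"
    and y_independent: "cvec.independent (y i ` Lam D i)"
    and y_span: "cvec.span (y i ` Lam D i) = free_space (Xs i)"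
proof -
  interpret comm_group "G i" by (rule comm_G[OF i])
  let ?N = "of_nat (card (carrier (G i))) :: complex"
  have N: "?N \<noteq> 0" using finite_G[OF i] one_closed by auto
  have pair: "(\<Sum>\<pi>\<in>carrier (G i). \<chi> i \<eta> \<pi> * y i \<zeta> (\<pi> (b i))) = (if \<eta> = \<zeta> then ?N else 0)"
    if labels: "\<eta> \<in> Lam D i" "\<zeta> \<in> Lam D i" for \<eta> \<zeta>
  proof (cases "\<eta> = \<zeta>")
    case True
    have "(\<Sum>\<pi>\<in>carrier (G i). \<chi> i \<eta> \<pi> * y i \<zeta> (\<pi> (b i))) = (\<Sum>\<pi>\<in>carrier (G i). 1)"
      using character_nonzero[OF chi_hom[OF i]]
      by (intro sum.cong refl) (simp add: True y_apply[OF i] character_inv[OF chi_hom[OF i]])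
    then show ?thesis using True by simp
  next
    case False
    then obtain g where "g \<in> carrier (G i)" "\<chi> i \<eta> g \<noteq> \<chi> i \<zeta> g"
      using chi_distinct[OF i labels] by blast
    then have "(\<Sum>\<pi>\<in>carrier (G i). \<chi> i \<eta> \<pi> * \<chi> i \<zeta> (inv\<^bsub>G i\<^esub> \<pi>)) = 0"
      by (rule character_orthogonality[OF chi_hom[OF i] chi_hom[OF i]])
    then show ?thesis using False by (simp add: y_apply[OF i])
  qed
  note bio = biorthogonal_imp_independent[OF card_Lam(2)[OF i] N pair]
  show inj: "inj_on (y i) (Lam D i)" by (rule bio(1))
  show ind: "cvec.independent (y i ` Lam D i)" by (rule bio(2))
  have fin: "finite (Xs i)" using orbit_subset[OF orb[OF i]] finX finite_subset by blast
  have "y i \<eta> \<in> cvec.span (basis_vec ` Xs i)" for \<eta>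
    unfolding yvec_def
  proof (rule cvec.span_sum)
    fix \<pi> assume \<pi>: "\<pi> \<in> carrier (G i)"
    have "\<pi> (b i) \<in> Xs i" by (rule PG_closed[OF \<pi>]) (use base i in blast)
    then have "basis_vec (\<pi> (b i)) \<in> cvec.span (basis_vec ` Xs i)"
      by (intro cvec.span_base imageI)
    then show "cscale (\<chi> i \<eta> (inv\<^bsub>G i\<^esub> \<pi>)) (basis_vec (\<pi> (b i))) \<in> cvec.span (basis_vec ` Xs i)"
      by (rule cvec.span_scale)
  qed
  moreover have "card (basis_vec ` Xs i) \<le> card (y i ` Lam D i)"
    using card_image[OF inj] card_Lam(1)[OF i] card_image_le[OF fin, of basis_vec] by simp
  ultimately show "cvec.span (y i ` Lam D i) = free_space (Xs i)"
    unfolding free_space_def using fin ind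
    by (intro independent_card_imp_span_eq finite_imageI image_subsetI)
qed

lemma lin_ext_r: "lin_ext X r F q = (if q \<in> X \<times> X then F (r q) else 0)"
proof (rule lin_ext_involution[OF finX _ r_involution])
  show "r q \<in> X \<times> X" if "q \<in> X \<times> X" for q
    using that by (auto simp: r_eq)
qed

lemma L_mem_orbit_iff:
  assumes "i \<in> {1..t}" "x \<in> X" "z \<in> X"
  shows "L x z \<in> Xs i \<longleftrightarrow> z \<in> Xs i"
proof -
  have bij: "bij_betw (L x) (Xs i) (Xs i)" and sub: "Xs i \<subseteq> X"
    using orbit_invariant[OF orb[OF assms(1)]] assms(2) by (auto simp: invariant_def)
  show ?thesis
  proof
    assume "L x z \<in> Xs i"
    then obtain w where w: "w \<in> Xs i" "L x z = L x w"
      using bij_betw_imp_surj_on[OF bij] by (metis imageE)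
    then have "z = w" using sub by (intro L_inj[OF assms(2,3)]) auto
    then show "z \<in> Xs i" using w by simp
  qed (use bij_betwE[OF bij] in blast)
qed

text \<open>At \<open>(u, v)\<close> the left side is \<open>y\<^sup>i\<^sub>\<eta>(L\<^sub>u v) y\<^sup>j\<^sub>\<zeta>(R\<^sub>v u)\<close>. For \<open>u \<in> X\<^sub>j\<close> and \<open>v \<in> X\<^sub>i\<close> these arguments are
  \<open>\<sigma>\<^sup>j\<^sub>i v\<close> and \<open>(\<sigma>\<^sup>i\<^sub>j)\<^sup>-\<^sup>1 u\<close>, so \<open>\<chi>\<^sub>\<eta>\<close> comes out inverted and \<open>\<chi>\<^sub>\<zeta>\<close> does not. In all other
  cases both sides vanish because \<open>L\<^sub>u\<close> and \<open>R\<^sub>v\<close> permute each orbit.\<close>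

lemma lin_ext_tensor_y:
  assumes i: "i \<in> {1..t}" and j: "j \<in> {1..t}"
  shows "lin_ext X r (tensor (y i \<eta>) (y j \<zeta>)) =
    cscale (\<chi> j \<zeta> (\<sigma> j i) / \<chi> i \<eta> (\<sigma> i j)) (tensor (y j \<zeta>) (y i \<eta>))"
proof
  fix q :: "'a \<times> 'a"
  obtain u v where q: "q = (u, v)" by (cases q)
  have sub: "Xs i \<subseteq> X" "Xs j \<subseteq> X" using orbit_subset orb i j by auto
  show "lin_ext X r (tensor (y i \<eta>) (y j \<zeta>)) q =
    cscale (\<chi> j \<zeta> (\<sigma> j i) / \<chi> i \<eta> (\<sigma> i j)) (tensor (y j \<zeta>) (y i \<eta>)) q"
  proof (cases "u \<in> Xs j \<and> v \<in> Xs i")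
    case True
    then have uv: "u \<in> X" "v \<in> X" using sub by auto
    have Rv: "R v u \<in> Xs j"
      using L_mem_orbit_iff[OF j uv(2), of "R v u"] uv True by (simp add: L_R)
    have "L u v = \<sigma> i j v"
      using True sigma_eq[OF i j, of u] by simp
    then have 1: "y i \<eta> (L u v) = y i \<eta> v / \<chi> i \<eta> (\<sigma> i j)"
      using y_eigenvector[OF i sigma_closed[OF i j], of v] True by simp
    have "u = \<sigma> j i (R v u)"
      using True sigma_eq[OF j i, of v] Rv uv by (simp add: L_R)
    then have "y j \<zeta> u = y j \<zeta> (R v u) / \<chi> j \<zeta> (\<sigma> j i)"
      using y_eigenvector[OF j sigma_closed[OF j i] Rv] by metis
    then have 2: "y j \<zeta> (R v u) = \<chi> j \<zeta> (\<sigma> j i) * y j \<zeta> u"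
      using character_nonzero[OF chi_hom[OF j] sigma_closed[OF j i]] by simp
    show ?thesis
      using uv by (simp add: q lin_ext_r r_eq tensor_def cscale_def 1 2)
  next
    case False
    then have zero: "y j \<zeta> u * y i \<eta> v = 0"
      using y_outside[OF i] y_outside[OF j] by auto
    have "y i \<eta> (L u v) * y j \<zeta> (R v u) = 0" if uv: "u \<in> X" "v \<in> X"
    proof -
      have "L u v \<notin> Xs i \<or> R v u \<notin> Xs j"
        using False L_mem_orbit_iff[OF i uv] L_mem_orbit_iff[OF j uv(2), of "R v u"] uv
        by (auto simp: L_R)
      then show ?thesis using y_outside[OF i] y_outside[OF j] by auto
    qed
    then show ?thesis
      using zero by (auto simp: q lin_ext_r r_eq tensor_def cscale_def)
  qed
qed

lemma chi_sigma:
  assumes i: "i \<in> {1..t}" and j: "j \<in> {1..t}"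
  shows "\<chi> i \<eta> (\<sigma> i j) = (\<Prod>k\<in>{1..rk D i}. (theta D i k ^ \<eta> k) ^ coord D i j k)"
proof -
  interpret cyclic_product "G i" "rk D i" "gen D i"
    by (rule cyclic_product_G[OF i])
  have "\<chi> i \<eta> (\<sigma> i j) = (\<Prod>k\<in>{1..rk D i}. \<chi> i \<eta> (gen D i k) ^ coord D i j k)"
    using character_power_product[OF chi_hom[OF i], of \<eta> "coord D i j"]
    by (simp only: sigma_power_product[OF i j] power_product_def)
  then show ?thesis
    by (simp add: chi_gen[OF i])
qed

end

theorem theorem4p9:
  fixes X :: "'a set" and r :: "'a \<times> 'a \<Rightarrow> 'a \<times> 'a"
    and n t t0 :: nat and Xs :: "nat \<Rightarrow> 'a set"
    and D :: "'a datum" and b :: "nat \<Rightarrow> 'a"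
  assumes "symmetric_set X r" and "nondegenerate X r" and "square_free X r"
    and "finite X" and "card X = n" and "mpl_eq_2 X r"
    and "orbit_enum X r t t0 Xs"
    and "complete_datum X r t t0 Xs D"
    and "\<forall>i\<in>{1..t}. b i \<in> Xs i"
  shows "(\<forall>i\<in>{1..t}.
            inj_on (yvec X r Xs D b i) (Lam D i) \<and>
            cvec.independent (yvec X r Xs D b i ` Lam D i) \<and>
            cvec.span (yvec X r Xs D b i ` Lam D i) = free_space (Xs i)) \<and>
         (\<forall>i\<in>{1..t}. \<forall>j\<in>{1..t}. \<forall>\<eta>\<in>Lam D i. \<forall>\<zeta>\<in>Lam D j.
            lin_ext X r (tensor (yvec X r Xs D b i \<eta>) (yvec X r Xs D b j \<zeta>)) =
            cscale (mu X r Xs D j i \<zeta> / mu X r Xs D i j \<eta>)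
              (tensor (yvec X r Xs D b j \<zeta>) (yvec X r Xs D b i \<eta>))) \<and>
         (\<forall>i\<in>{1..t}. \<forall>j\<in>{1..t}. \<forall>\<eta>\<in>Lam D i.
            mu X r Xs D i j \<eta> = (\<Prod>k\<in>{1..rk D i}. (theta D i k ^ \<eta> k) ^ coord D i j k))"
proof -
  interpret sqfree_mpl2_datum X r t t0 Xs D b
    using assms by unfold_locales
  show ?thesis
    unfolding mu_def
    by (intro conjI ballI y_inj y_independent y_span lin_ext_tensor_y chi_sigma)
qed

end
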